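(* Let $\Delta$ be a fan triangulation of a polygon with $n$ internal diagonals, and let $\gamma$ be the fan face. Then the expansion poset $\mathbb T_\gamma$ is isomorphic to a chain with $n+1$ vertices.
   Context: A fan triangulation of an $(n+3)$-gon has all $n$ internal diagonals sharing a common endpoint $k$ (the fan vertex). The fan face is the triangle with vertices $k$ and the two neighbours of $k$ on the polygon; every internal diagonal has its endpoint $k$ on this face and crosses the opposite side. The cluster algebra is that of configurations of affine flags for $\mathrm{SL}_3$ on the polygon (Fock–Goncharov). The initial seed of $\Delta$ has two variables $x_{ij},x_{ji}$ for each edge $\{i,j\}$ of $\Delta$ (attached to the directed edges $i\to j$, $j\to i$; those of boundary edges are frozen) and one variable $x_{ijk}$ for each triangle $ijk$ of $\Delta$. The quiver has, for each triangle and each vertex $p$ of it, with $p,t,b$ the vertices in clockwise order, the $3$-cycle $x_{pt}\to x_{ptb}\to x_{pb}\to x_{pt}$. Flipping the diagonal $kl$ to $ij$ in a quadrilateral with triangles $ikl,jkl$ means mutating at $x_{kl},x_{lk}$ and then at $x_{ikl},x_{jkl}$, giving $x_{kl}x_{ijk}=x_{ki}x_{jkl}+x_{kj}x_{ikl}$, $x_{lk}x_{ijl}=x_{li}x_{jkl}+x_{lj}x_{ikl}$, $x_{ikl}x_{ij}=x_{ik}x_{ijl}+x_{il}x_{ijk}$, $x_{jkl}x_{ji}=x_{jk}x_{ijl}+x_{jl}x_{ijk}$. Thus each face of the polygon has a cluster variable. $\mathbb T_\gamma$ is the set of Laurent monomials in the expansion of $x_\gamma$ in the initial seed, partially ordered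 by the covering relations: $m'$ covers $m$ if $m'=\hat y\,m$ for some mutable node, where for a node $v$ of the quiver $\hat y_v=\prod_{u\to v}x_u/\prod_{v\to u}x_u$. *)

theory Defs
  imports
    "HOL-Library.Poly_Mapping"
    "HOL-Library.FSet"
    "HOL-Combinatorics.Transposition"
    "HOL-Computational_Algebra.Polynomial_Factorial"
begin

section \<open>Seeds and mutation\<close>

text \<open>
  A quiver without loops and 2-cycles is given by its skew-symmetric matrix:
  \<open>exch s u v\<close> is the number of arrows from \<open>u\<close> to \<open>v\<close> minus the number of arrows from \<open>v\<close>
  to \<open>u\<close>. The nodes of the quiver are not recorded; all other elements of the node type are
  isolated and are never mutated.
\<close>

record ('v, 'f) seed =
  exch :: "'v \<Rightarrow> 'v \<Rightarrow> int"
  var :: "'v \<Rightarrow> 'f"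

definition mutate :: "'v \<Rightarrow> ('v, 'f::field) seed \<Rightarrow> ('v, 'f) seed" where
  "mutate v s = (let b = exch s; x = var s in
     \<lparr> exch = (\<lambda>u w. if u = v \<or> w = v then - b u w
         else b u w + max 0 (b u v) * max 0 (b v w) - max 0 (b w v) * max 0 (b v u)),
       var = x(v := ((\<Prod>u \<in> {u. b u v > 0}. x u ^ nat (b u v))
                   + (\<Prod>u \<in> {u. b v u > 0}. x u ^ nat (b v u))) / x v) \<rparr>)"

definition rename_nodes :: "('v \<Rightarrow> 'v) \<Rightarrow> ('v, 'f) seed \<Rightarrow> ('v, 'f) seed" where
  "rename_nodes \<pi> s = \<lparr> exch = (\<lambda>u v. exch s (\<pi> u) (\<pi> v)), var = (\<lambda>u. var s (\<pi> u)) \<rparr>"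


section \<open>Triangulations of a polygon\<close>

text \<open>
  The vertices of the \<open>N\<close>-gon are \<open>0, \<dots>, N - 1\<close> in clockwise order. A triangulation is a set of
  segments which includes the sides of the polygon (these cross no segment, so they belong to
  every maximal noncrossing set).
\<close>

definition segments :: "nat \<Rightarrow> nat set set" where
  "segments N = {{i, j} | i j. i < N \<and> j < N \<and> i \<noteq> j}"

definition sides :: "nat \<Rightarrow> nat set set" where
  "sides N = {{i, (i + 1) mod N} | i. i < N}"

definition crossing :: "nat set \<Rightarrow> nat set \<Rightarrow> bool" where
  "crossing d e \<longleftrightarrow> (\<exists>a b a' b'. a < b \<and> b < a' \<and> a' < b' \<and>
     (d = {a, a'} \<and> e = {b, b'} \<or> e = {a, a'} \<and> d = {b, b'}))"

definition triangulation :: "nat \<Rightarrow> nat set set \<Rightarrow> bool" where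
  "triangulation N T \<longleftrightarrow> T \<subseteq> segments N \<and> (\<forall>d\<in>T. \<forall>e\<in>T. \<not> crossing d e) \<and>
     (\<forall>d \<in> segments N - T. \<exists>e\<in>T. crossing d e)"

text \<open>In a triangulation of a convex polygon any three pairwise joined vertices span a triangle.\<close>

definition is_triangle :: "nat set set \<Rightarrow> nat \<Rightarrow> nat \<Rightarrow> nat \<Rightarrow> bool" where
  "is_triangle T i j k \<longleftrightarrow> i \<noteq> j \<and> j \<noteq> k \<and> i \<noteq> k \<and> {i, j} \<in> T \<and> {j, k} \<in> T \<and> {i, k} \<in> T"

definition is_face_of :: "nat set set \<Rightarrow> nat fset \<Rightarrow> bool" where
  "is_face_of T \<gamma> \<longleftrightarrow> (\<exists>i j k. \<gamma> = {|i, j, k|} \<and> is_triangle T i j k)"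

definition clockwise :: "nat \<Rightarrow> nat \<Rightarrow> nat \<Rightarrow> bool" where
  "clockwise p t b \<longleftrightarrow> (p < t \<and> t < b) \<or> (t < b \<and> b < p) \<or> (b < p \<and> p < t)"

definition fan_triangulation :: "nat \<Rightarrow> nat set set \<Rightarrow> nat \<Rightarrow> bool" where
  "fan_triangulation N T k \<longleftrightarrow> triangulation N T \<and> k < N \<and> (\<forall>d \<in> T - sides N. k \<in> d)"

definition fan_face :: "nat \<Rightarrow> nat \<Rightarrow> nat fset" where
  "fan_face N k = {|k, (k + 1) mod N, (k + N - 1) mod N|}"


section \<open>The \<open>SL\<^sub>3\<close> cluster structure\<close>

text \<open>\<open>Edge i j\<close> carries \<open>x\<^sub>i\<^sub>j\<close> (a directed edge), \<open>Face {|i, j, k|}\<close> carries \<open>x\<^sub>i\<^sub>j\<^sub>k\<close>.\<close>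

datatype node = Edge nat nat | Face "nat fset"

instance node :: countable
  by countable_datatype

text \<open>
  An arbitrary linear order; its only purpose is the library instance by which the ring of
  Laurent polynomials below is an integral domain.
\<close>

instantiation node :: linorder
begin
definition "u \<le> v \<longleftrightarrow> to_nat (u :: node) \<le> to_nat (v :: node)"
definition "u < v \<longleftrightarrow> to_nat (u :: node) < to_nat (v :: node)"
instance
  by intro_classes (auto simp: less_eq_node_def less_node_def)
end

text \<open>
  Laurent monomials are exponent vectors, so they are multiplied by adding them. Cluster
  variables live in the fraction field of the ring of Laurent polynomials.
\<close>

type_synonym monomial = "node \<Rightarrow>\<^sub>0 int"
type_synonym laurent = "monomial \<Rightarrow>\<^sub>0 int"

definition indeterminate :: "node \<Rightarrow> laurent fract" where
  "indeterminate v = to_fract (Poly_Mapping.single (Poly_Mapping.single v 1) 1)"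

definition arrow :: "nat set set \<Rightarrow> node \<Rightarrow> node \<Rightarrow> bool" where
  "arrow T u v \<longleftrightarrow> (\<exists>p t b. clockwise p t b \<and> is_triangle T p t b \<and>
     (u = Edge p t \<and> v = Face {|p, t, b|} \<or>
      u = Face {|p, t, b|} \<and> v = Edge p b \<or>
      u = Edge p b \<and> v = Edge p t))"

text \<open>
  An arrow determines the clockwise triple \<open>(p, t, b)\<close> from which it arises and no two arrows are
  opposite, so a relation suffices to describe the quiver.
\<close>

definition initial_seed :: "nat set set \<Rightarrow> (node, laurent fract) seed" where
  "initial_seed T =
     \<lparr> exch = (\<lambda>u v. of_bool (arrow T u v) - of_bool (arrow T v u)), var = indeterminate \<rparr>"

definition mutable_nodes :: "nat \<Rightarrow> nat set set \<Rightarrow> node set" where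
  "mutable_nodes N T =
     {Edge i j | i j. {i, j} \<in> T - sides N} \<union> {Face {|i, j, k|} | i j k. is_triangle T i j k}"

text \<open>
  Flip of \<open>kl\<close> to \<open>ij\<close>. The mutated nodes are then renamed according to the exchange relations:
  the new variable at \<open>Edge k l\<close> is \<open>x\<^sub>i\<^sub>j\<^sub>k\<close>, at \<open>Edge l k\<close> it is \<open>x\<^sub>i\<^sub>j\<^sub>l\<close>, at \<open>Face {|i, k, l|}\<close>
  it is \<open>x\<^sub>i\<^sub>j\<close> and at \<open>Face {|j, k, l|}\<close> it is \<open>x\<^sub>j\<^sub>i\<close>.
\<close>

definition flip_seed ::
    "nat \<Rightarrow> nat \<Rightarrow> nat \<Rightarrow> nat \<Rightarrow> (node, 'f::field) seed \<Rightarrow> (node, 'f) seed" where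
  "flip_seed i j k l s =
     rename_nodes
       (transpose (Edge k l) (Face {|i, j, k|}) \<circ> transpose (Edge l k) (Face {|i, j, l|}) \<circ>
        transpose (Face {|i, k, l|}) (Edge i j) \<circ> transpose (Face {|j, k, l|}) (Edge j i))
       (mutate (Face {|j, k, l|}) (mutate (Face {|i, k, l|})
         (mutate (Edge l k) (mutate (Edge k l) s))))"

inductive flip_reachable :: "nat set set \<Rightarrow> nat set set \<Rightarrow> (node, laurent fract) seed \<Rightarrow> bool"
  for \<Delta> :: "nat set set" where
  initial: "flip_reachable \<Delta> \<Delta> (initial_seed \<Delta>)"
| flip: "flip_reachable \<Delta> T s \<Longrightarrow> is_triangle T i k l \<Longrightarrow> is_triangle T j k l \<Longrightarrow> i \<noteq> j \<Longrightarrow>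
    flip_reachable \<Delta> (insert {i, j} (T - {{k, l}})) (flip_seed i j k l s)"

text \<open>
  The cluster variable of a face does not depend on the sequence of flips by which a
  triangulation containing the face is reached.
\<close>

definition face_variable :: "nat set set \<Rightarrow> nat fset \<Rightarrow> laurent fract" where
  "face_variable \<Delta> \<gamma> =
     (THE x. \<exists>T s. flip_reachable \<Delta> T s \<and> is_face_of T \<gamma> \<and> x = var s (Face \<gamma>))"


section \<open>The expansion poset\<close>

definition expansion :: "nat set set \<Rightarrow> nat fset \<Rightarrow> laurent" where
  "expansion \<Delta> \<gamma> = (THE P. to_fract P = face_variable \<Delta> \<gamma>)"

definition expansion_monomials :: "nat set set \<Rightarrow> nat fset \<Rightarrow> monomial set" where
  "expansion_monomials \<Delta> \<gamma> = Poly_Mapping.keys (expansion \<Delta> \<gamma>)"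

definition y_hat :: "nat set set \<Rightarrow> node \<Rightarrow> monomial" where
  "y_hat \<Delta> v = (\<Sum>u \<in> {u. arrow \<Delta> u v}. Poly_Mapping.single u 1)
              - (\<Sum>u \<in> {u. arrow \<Delta> v u}. Poly_Mapping.single u 1)"

definition expansion_covers ::
    "nat \<Rightarrow> nat set set \<Rightarrow> nat fset \<Rightarrow> monomial \<Rightarrow> monomial \<Rightarrow> bool" where
  "expansion_covers N \<Delta> \<gamma> m m' \<longleftrightarrow>
     m \<in> expansion_monomials \<Delta> \<gamma> \<and> m' \<in> expansion_monomials \<Delta> \<gamma> \<and>
     (\<exists>v \<in> mutable_nodes N \<Delta>. m' = y_hat \<Delta> v + m)"

definition expansion_le ::
    "nat \<Rightarrow> nat set set \<Rightarrow> nat fset \<Rightarrow> monomial \<Rightarrow> monomial \<Rightarrow> bool" where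
  "expansion_le N \<Delta> \<gamma> = (expansion_covers N \<Delta> \<gamma>)\<^sup>*\<^sup>*"

end

theory Submission
  imports Defs
begin

text \<open>
  The cluster variables of the polygon are coordinates of affine flags. Given vectors \<open>v\<^sub>i\<close> and
  covectors \<open>\<xi>\<^sub>i\<close> in dimension three with \<open>\<xi>\<^sub>i(v\<^sub>i) = 0\<close>, put \<open>x\<^sub>i\<^sub>j = \<xi>\<^sub>i(v\<^sub>j)\<close> and
  \<open>x\<^sub>i\<^sub>j\<^sub>k = det(v\<^sub>i, v\<^sub>j, v\<^sub>k)\<close> for clockwise \<open>i, j, k\<close>. Any four of the vectors are linearly dependent,
  and applying one of the covectors to this dependence gives each of the exchange relations of a
  flip. So if the initial variables are coordinates of flags, then by induction along the flips so
  are all others (\<open>flip_reachable_invariant\<close>), and the variable of a face depends on the face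
  only (\<open>face_variable_eq\<close>). The induction has two further ingredients. The quiver of every seed
  is the quiver of its triangulation: mutation is a local operation (\<open>mutate_local\<close>), whence this is
  a finite calculation inside a quadrilateral (\<open>flip_seed_quad\<close>). And variables that occur as
  denominators are nonzero, because all variables are subtraction-free.

  For a fan with apex \<open>k\<close>, count the vertices clockwise from the apex, which gets position \<open>0\<close>. Flags
  with the prescribed initial coordinates can be written down (\<open>fan_flags\<close>), with
  \<open>v\<^sub>0 = (1, 0, 0)\<close>, \<open>\<xi>\<^sub>0 = (0, 1, 0)\<close> and \<open>v\<^sub>p = x\<^sub>0\<^sub>p (\<alpha>\<^sub>p, 1, \<beta>\<^sub>p)\<close>. Then
  \<open>det(v\<^sub>0, v\<^sub>p, v\<^sub>q) = x\<^sub>0\<^sub>p x\<^sub>0\<^sub>q (\<beta>\<^sub>q - \<beta>\<^sub>p)\<close>, so the triangles of the fan determine the differences of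
  successive \<open>\<beta>\<^sub>p\<close>, and the variable of the fan face is the product of \<open>x\<^sub>0\<^sub>1\<close> and \<open>x\<^sub>0\<^sub>p\<close> for
  \<open>p = n + 2\<close> with the telescoping sum of the \<open>n + 1\<close> terms \<open>x\<^sub>0\<^sub>m\<^sub>,\<^sub>m\<^sub>+\<^sub>1 / (x\<^sub>0\<^sub>m x\<^sub>0\<^sub>,\<^sub>m\<^sub>+\<^sub>1)\<close>
  (\<open>face_variable_fan_face\<close>).

  The quotient of two consecutive terms is the monomial \<open>y_hat\<close> of the diagonal that separates
  the two triangles involved (\<open>y_hat_spoke\<close>). Every other mutable node is the head of an arrow from
  a directed edge that does not start at the apex (\<open>mutable_cases\<close>); the variable of such an edge
  occurs in no term, so these nodes yield no covering relations. Thus the terms form a chain.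
\<close>

section \<open>Mutation is local\<close>

lemma transpose_disjoint_commute:
  "a \<noteq> c \<Longrightarrow> a \<noteq> d \<Longrightarrow> b \<noteq> c \<Longrightarrow> b \<noteq> d \<Longrightarrow>
   Transposition.transpose a b \<circ> Transposition.transpose c d =
   Transposition.transpose c d \<circ> Transposition.transpose a b"
  by (auto simp: fun_eq_iff Transposition.transpose_def)

definition mutate_matrix :: "'a \<Rightarrow> ('a \<Rightarrow> 'a \<Rightarrow> int) \<Rightarrow> 'a \<Rightarrow> 'a \<Rightarrow> int" where
  "mutate_matrix v b = (\<lambda>u w. if u = v \<or> w = v then - b u w
     else b u w + max 0 (b u v) * max 0 (b v w) - max 0 (b w v) * max 0 (b v u))"

lemma exch_mutate: "exch (mutate v s) = mutate_matrix v (exch s)"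
  by (simp add: mutate_def mutate_matrix_def Let_def)

lemma var_mutate: "var (mutate v s) = (var s)(v :=
   ((\<Prod>u \<in> {u. exch s u v > 0}. var s u ^ nat (exch s u v))
    + (\<Prod>u \<in> {u. exch s v u > 0}. var s u ^ nat (exch s v u))) / var s v)"
  by (simp add: mutate_def Let_def)

lemma mutate_commute:
  assumes "u \<noteq> v" "exch s u v = 0" "exch s v u = 0"
  shows "mutate u (mutate v s) = mutate v (mutate u s)"
proof -
  have e: "exch (mutate u (mutate v s)) = exch (mutate v (mutate u s))"
    using assms by (auto simp: exch_mutate mutate_matrix_def fun_eq_iff)
  have *: "var (mutate u (mutate v s)) = (var (mutate v s))(u := var (mutate u s) u)"
    if "u \<noteq> v" "exch s u v = 0" "exch s v u = 0" for u v
  proof -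
    have 1: "exch (mutate v s) x u = exch s x u" "exch (mutate v s) u x = exch s u x" for x
      using that by (auto simp: exch_mutate mutate_matrix_def)
    have 2: "(\<Prod>x \<in> {x. exch s x u > 0}. var (mutate v s) x ^ nat (exch s x u)) =
        (\<Prod>x \<in> {x. exch s x u > 0}. var s x ^ nat (exch s x u))"
      using that by (intro prod.cong) (auto simp: var_mutate)
    have 3: "(\<Prod>x \<in> {x. exch s u x > 0}. var (mutate v s) x ^ nat (exch s u x)) =
        (\<Prod>x \<in> {x. exch s u x > 0}. var s x ^ nat (exch s u x))"
      using that by (intro prod.cong) (auto simp: var_mutate)
    have 4: "var (mutate v s) u = var s u"
      using that by (simp add: var_mutate)
    show ?thesis
      by (simp add: var_mutate[of u] 1 2 3 4)
  qed
  have "var (mutate u (mutate v s)) = var (mutate v (mutate u s))"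
    unfolding *[OF assms] *[OF assms(1)[symmetric] assms(3,2)]
    using assms by (auto simp: var_mutate)
  with e show ?thesis by (simp add: seed.equality)
qed

definition transport :: "('a \<Rightarrow> 'v) \<Rightarrow> ('a \<Rightarrow> 'a \<Rightarrow> int) \<Rightarrow> 'v \<Rightarrow> 'v \<Rightarrow> int" where
  "transport e M u w = (if u \<in> range e \<and> w \<in> range e then M (inv e u) (inv e w) else 0)"

lemma transport_apply: "inj e \<Longrightarrow> transport e M (e a) (e b) = M a b"
  by (simp add: transport_def)

text \<open>
  Arrows that avoid the mutated node and nodes that are not adjacent to it have no influence on a
  mutation. So if the quiver is the sum of a piece living on the image of \<open>e\<close> and a rest \<open>R\<close> that
  does not touch \<open>e a\<close>, then mutation at \<open>e a\<close> can be computed on the piece alone. The neighbours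
  are restricted to two sources and two targets joined by single arrows, as this is the situation
  at each of the four mutations of a flip.
\<close>

lemma mutate_local:
  fixes e :: "'a \<Rightarrow> 'v" and s :: "('v, 'f::field) seed"
  assumes e: "inj e"
    and s: "exch s = (\<lambda>u w. R u w + transport e M u w)"
    and R: "\<And>u. R (e a) u = 0" "\<And>u. R u (e a) = 0"
    and M': "mutate_matrix a M = M'"
    and src: "{b. M b a > 0} = {b1, b2}" "b1 \<noteq> b2" "M b1 a = 1" "M b2 a = 1"
    and tgt: "{b. M a b > 0} = {c1, c2}" "c1 \<noteq> c2" "M a c1 = 1" "M a c2 = 1"
  shows "mutate (e a) s = \<lparr> exch = (\<lambda>u w. R u w + transport e M' u w),
    var = (var s)(e a := (var s (e b1) * var s (e b2) + var s (e c1) * var s (e c2)) / var s (e a)) \<rparr>"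
proof -
  have "exch (mutate (e a) s) u w = R u w + transport e M' u w" for u w
    using R e unfolding exch_mutate s M'[symmetric]
    by (auto simp: mutate_matrix_def transport_def inv_f_eq)
  moreover have "{u. exch s u (e a) > 0} = e ` {b. M b a > 0}"
    using R e by (auto simp: s transport_def inj_eq)
  moreover have "{u. exch s (e a) u > 0} = e ` {b. M a b > 0}"
    using R e by (auto simp: s transport_def inj_eq)
  ultimately show ?thesis
    using e src tgt R by (intro seed.equality) (auto simp: fun_eq_iff var_mutate s transport_apply inj_eq)
qed

section \<open>The flip of a quadrilateral\<close>

text \<open>
  Nodes of the quivers of the two triangulations of a quadrilateral with corners \<open>k, i, l, j\<close> in
  clockwise order: \<open>AB\<close> is the directed edge and \<open>ABC\<close> the triangle. The four matrices \<open>quad1\<close> to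
  \<open>quad4\<close> below are those after mutation at \<open>KL\<close>, \<open>LK\<close>, \<open>IKL\<close> and \<open>JKL\<close>; the last one is the
  quiver of the other triangulation up to the renaming \<open>flip_node\<close>. All of this is a finite
  calculation with sixteen nodes.
\<close>

datatype quad_node = KI | IK | IL | LI | LJ | JL | JK | KJ | KL | LK | IKL | JKL | IJK | IJL | IJ | JI

definition quad_nodes :: "quad_node list" where
  "quad_nodes = [KI, IK, IL, LI, LJ, JL, JK, KJ, KL, LK, IKL, JKL, IJK, IJL, IJ, JI]"

lemma set_quad_nodes: "set quad_nodes = UNIV"
proof -
  have "x \<in> set quad_nodes" for x
    by (cases x) (simp_all add: quad_nodes_def)
  then show ?thesis by auto
qed

definition arrows_matrix :: "('a \<times> 'a) list \<Rightarrow> 'a \<Rightarrow> 'a \<Rightarrow> int" where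
  "arrows_matrix A u v = of_bool ((u, v) \<in> set A) - of_bool ((v, u) \<in> set A)"

lemma transport_arrows_matrix:
  assumes "inj e"
  shows "transport e (arrows_matrix A) u v =
    of_bool ((u, v) \<in> map_prod e e ` set A) - of_bool ((v, u) \<in> map_prod e e ` set A)"
  using assms by (auto simp: transport_def arrows_matrix_def inj_eq image_iff map_prod_def)

definition quad_arrows where
  "quad_arrows =
    [(KI, IKL), (IKL, KL), (KL, KI), (IL, IKL), (IKL, IK), (IK, IL),
     (LK, IKL), (IKL, LI), (LI, LK), (KL, JKL), (JKL, KJ), (KJ, KL),
     (LJ, JKL), (JKL, LK), (LK, LJ), (JK, JKL), (JKL, JL), (JL, JK)]"

definition quad0 where
  "quad0 = arrows_matrix quad_arrows"

definition quad1 where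
  "quad1 = arrows_matrix
    [(KI, KL), (IK, IL), (IL, IKL), (LI, LK), (LJ, JKL), (JL, JK),
     (JK, JKL), (KJ, KI), (KL, KJ), (KL, IKL), (LK, LJ), (LK, IKL),
     (IKL, IK), (IKL, LI), (IKL, JKL), (JKL, JL), (JKL, KL), (JKL, LK)]"

definition quad2 where
  "quad2 = arrows_matrix
    [(KI, KL), (IK, IL), (IL, IKL), (LI, LJ), (LJ, LK), (JL, JK),
     (JK, JKL), (KJ, KI), (KL, KJ), (KL, IKL), (LK, LI), (LK, JKL),
     (IKL, IK), (IKL, LK), (JKL, JL), (JKL, KL)]"

definition quad3 where
  "quad3 = arrows_matrix
    [(KI, KL), (IK, IKL), (IL, LK), (LI, LJ), (LJ, LK), (JL, JK),
     (JK, JKL), (KJ, KI), (KL, IK), (KL, KJ), (KL, LK), (LK, LI),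
     (LK, IKL), (LK, JKL), (IKL, IL), (IKL, KL), (JKL, JL), (JKL, KL)]"

definition quad4 where
  "quad4 = arrows_matrix
    [(KI, KL), (IK, IKL), (IL, LK), (LI, LJ), (LJ, LK), (JL, JKL),
     (JK, KL), (KJ, KI), (KL, IK), (KL, KJ), (KL, JKL), (LK, LI),
     (LK, JL), (LK, IKL), (IKL, IL), (IKL, KL), (JKL, JK), (JKL, LK)]"

definition flipped_quad_arrows where
  "flipped_quad_arrows =
    [(IL, IJL), (IJL, IJ), (IJ, IL), (LJ, IJL), (IJL, LI), (LI, LJ),
     (JI, IJL), (IJL, JL), (JL, JI), (IJ, IJK), (IJK, IK), (IK, IJ),
     (JK, IJK), (IJK, JI), (JI, JK), (KI, IJK), (IJK, KJ), (KJ, KI)]"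

definition flipped_quad where
  "flipped_quad = arrows_matrix flipped_quad_arrows"

lemma quad_node_eqI:
  assumes "\<forall>x \<in> set quad_nodes. \<forall>y \<in> set quad_nodes. M x y = M' x y"
  shows "M = M'"
  using assms by (auto simp: set_quad_nodes fun_eq_iff)

lemma quad_mutations:
  "mutate_matrix KL quad0 = quad1"
  "mutate_matrix LK quad1 = quad2"
  "mutate_matrix IKL quad2 = quad3"
  "mutate_matrix JKL quad3 = quad4"
  by (rule quad_node_eqI, code_simp)+

lemma quad_node_set_eqI:
  assumes "\<forall>x \<in> set quad_nodes. P x \<longleftrightarrow> x = a \<or> x = b"
  shows "{x. P x} = {a, b}"
  using assms by (auto simp: set_quad_nodes)

lemma quad_neighbours:
  "{b. quad0 b KL > 0} = {KJ, IKL}" "{b. quad0 KL b > 0} = {KI, JKL}"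
  "{b. quad1 b LK > 0} = {LI, JKL}" "{b. quad1 LK b > 0} = {LJ, IKL}"
  "{b. quad2 b IKL > 0} = {IL, KL}" "{b. quad2 IKL b > 0} = {IK, LK}"
  "{b. quad3 b JKL > 0} = {JK, LK}" "{b. quad3 JKL b > 0} = {JL, KL}"
  by (rule quad_node_set_eqI, code_simp)+

lemma quad_entries:
  "quad0 KJ KL = 1" "quad0 IKL KL = 1" "quad0 KL KI = 1" "quad0 KL JKL = 1"
  "quad1 LI LK = 1" "quad1 JKL LK = 1" "quad1 LK LJ = 1" "quad1 LK IKL = 1"
  "quad2 IL IKL = 1" "quad2 KL IKL = 1" "quad2 IKL IK = 1" "quad2 IKL LK = 1"
  "quad3 JK JKL = 1" "quad3 LK JKL = 1" "quad3 JKL JL = 1" "quad3 JKL KL = 1"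
  by code_simp+

fun flip_node :: "quad_node \<Rightarrow> quad_node" where
  "flip_node KL = IJK" | "flip_node IJK = KL" | "flip_node LK = IJL" | "flip_node IJL = LK"
| "flip_node IKL = IJ" | "flip_node IJ = IKL" | "flip_node JKL = JI" | "flip_node JI = JKL"
| "flip_node x = x"

lemma quad_flip: "(\<lambda>x y. quad4 (flip_node x) (flip_node y)) = flipped_quad"
  by (rule quad_node_eqI, code_simp)

fun quad_embed :: "nat \<Rightarrow> nat \<Rightarrow> nat \<Rightarrow> nat \<Rightarrow> quad_node \<Rightarrow> node" where
  "quad_embed i j k l KI = Edge k i" | "quad_embed i j k l IK = Edge i k"
| "quad_embed i j k l IL = Edge i l" | "quad_embed i j k l LI = Edge l i"
| "quad_embed i j k l LJ = Edge l j" | "quad_embed i j k l JL = Edge j l"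
| "quad_embed i j k l JK = Edge j k" | "quad_embed i j k l KJ = Edge k j"
| "quad_embed i j k l KL = Edge k l" | "quad_embed i j k l LK = Edge l k"
| "quad_embed i j k l IJ = Edge i j" | "quad_embed i j k l JI = Edge j i"
| "quad_embed i j k l IKL = Face {|i, k, l|}" | "quad_embed i j k l JKL = Face {|j, k, l|}"
| "quad_embed i j k l IJK = Face {|i, j, k|}" | "quad_embed i j k l IJL = Face {|i, j, l|}"

lemma inj_quad_embed:
  assumes "distinct [i, j, k, l]"
  shows "inj (quad_embed i j k l)"
proof -
  \<comment> \<open>With unknowns for the four faces, only the edges are left to compare.\<close>
  have nodes: "distinct [Edge k i, Edge i k, Edge i l, Edge l i, Edge l j, Edge j l, Edge j k, Edge k j,
      Edge k l, Edge l k, Face A, Face B, Face C, Face D, Edge i j, Edge j i]"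
    if "distinct [A, B, C, D]" for A B C D
    using assms that by simp
  have "distinct [{|i, k, l|}, {|j, k, l|}, {|i, j, k|}, {|i, j, l|}]"
    using assms by (auto simp: fset_eq_iff)
  then have "distinct (map (quad_embed i j k l) quad_nodes)"
    unfolding quad_nodes_def list.map quad_embed.simps by (rule nodes)
  then show ?thesis
    by (simp add: distinct_map set_quad_nodes)
qed

text \<open>
  The four right-hand sides are the exchange relations of a flip. The hypothesis on \<open>R\<close> says that
  no arrow outside the quadrilateral touches one of the eight nodes that are mutated or renamed.
\<close>

lemma flip_seed_quad:
  fixes s :: "(node, 'f::field) seed"
  assumes dist: "distinct [i, j, k, l]"
    and s: "exch s = (\<lambda>u w. R u w + transport (quad_embed i j k l) quad0 u w)"
    and R: "\<And>a u. flip_node a \<noteq> a \<Longrightarrow> R (quad_embed i j k l a) u = 0"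
      "\<And>a u. flip_node a \<noteq> a \<Longrightarrow> R u (quad_embed i j k l a) = 0"
  defines "y \<equiv> var (flip_seed i j k l s)" and "x \<equiv> \<lambda>a. var s (quad_embed i j k l a)"
  shows "exch (flip_seed i j k l s) = (\<lambda>u w. R u w + transport (quad_embed i j k l) flipped_quad u w)"
    and "y (Face {|i, j, k|}) = (x KJ * x IKL + x KI * x JKL) / x KL"
    and "y (Face {|i, j, l|}) = (x LI * x JKL + x LJ * x IKL) / x LK"
    and "y (Edge i j) = (x IL * y (Face {|i, j, k|}) + x IK * y (Face {|i, j, l|})) / x IKL"
    and "y (Edge j i) = (x JK * y (Face {|i, j, l|}) + x JL * y (Face {|i, j, k|})) / x JKL"
    and "\<And>u. (\<And>a. flip_node a \<noteq> a \<Longrightarrow> u \<noteq> quad_embed i j k l a) \<Longrightarrow> y u = var s u"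
proof -
  let ?e = "quad_embed i j k l"
  have e: "inj ?e" by (rule inj_quad_embed[OF dist])
  have e_iff: "?e a = ?e b \<longleftrightarrow> a = b" for a b
    using e by (simp add: inj_eq)
  define \<pi> where "\<pi> = transpose (?e KL) (?e IJK) \<circ> transpose (?e LK) (?e IJL) \<circ>
    transpose (?e IKL) (?e IJ) \<circ> transpose (?e JKL) (?e JI)"
  have \<pi>_e: "\<pi> (?e a) = ?e (flip_node a)" for a
    unfolding \<pi>_def comp_def by (cases a) (simp_all del: quad_embed.simps add: transpose_def e_iff)
  have \<pi>_other: "\<pi> u = u" if "\<And>a. flip_node a \<noteq> a \<Longrightarrow> u \<noteq> ?e a" for u
    using that[of KL] that[of LK] that[of IKL] that[of JKL] that[of IJK] that[of IJL] that[of IJ] that[of JI]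
    by (simp add: \<pi>_def transpose_def)
  define s1 where "s1 = mutate (?e KL) s"
  define s2 where "s2 = mutate (?e LK) s1"
  define s3 where "s3 = mutate (?e IKL) s2"
  define s4 where "s4 = mutate (?e JKL) s3"
  have flip: "flip_seed i j k l s = rename_nodes \<pi> s4"
    by (simp add: flip_seed_def \<pi>_def s1_def s2_def s3_def s4_def)
  note R8 = R[of KL] R[of LK] R[of IKL] R[of JKL]
  have s1: "s1 = \<lparr> exch = (\<lambda>u w. R u w + transport ?e quad1 u w),
      var = (var s)(?e KL := (x KJ * x IKL + x KI * x JKL) / x KL) \<rparr>"
    unfolding s1_def x_def
    by (rule mutate_local[OF e s _ _ quad_mutations(1) quad_neighbours(1) _ _ _ quad_neighbours(2)])
      (use R8 in \<open>simp_all add: quad_entries\<close>)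
  have s2: "s2 = \<lparr> exch = (\<lambda>u w. R u w + transport ?e quad2 u w),
      var = (var s1)(?e LK := (var s1 (?e LI) * var s1 (?e JKL) + var s1 (?e LJ) * var s1 (?e IKL)) / var s1 (?e LK)) \<rparr>"
    unfolding s2_def
    by (rule mutate_local[where R = R, OF e _ _ _ quad_mutations(2) quad_neighbours(3) _ _ _ quad_neighbours(4)])
      (use R8 in \<open>simp_all add: quad_entries s1\<close>)
  have s3: "s3 = \<lparr> exch = (\<lambda>u w. R u w + transport ?e quad3 u w),
      var = (var s2)(?e IKL := (var s2 (?e IL) * var s2 (?e KL) + var s2 (?e IK) * var s2 (?e LK)) / var s2 (?e IKL)) \<rparr>"
    unfolding s3_def
    by (rule mutate_local[where R = R, OF e _ _ _ quad_mutations(3) quad_neighbours(5) _ _ _ quad_neighbours(6)])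
      (use R8 in \<open>simp_all add: quad_entries s2\<close>)
  have s4: "s4 = \<lparr> exch = (\<lambda>u w. R u w + transport ?e quad4 u w),
      var = (var s3)(?e JKL := (var s3 (?e JK) * var s3 (?e LK) + var s3 (?e JL) * var s3 (?e KL)) / var s3 (?e JKL)) \<rparr>"
    unfolding s4_def
    by (rule mutate_local[where R = R, OF e _ _ _ quad_mutations(4) quad_neighbours(7) _ _ _ quad_neighbours(8)])
      (use R8 in \<open>simp_all add: quad_entries s3\<close>)
  have y: "y u = var s4 (\<pi> u)" for u
    by (simp add: y_def flip rename_nodes_def)
  have yA: "y (?e IJK) = (x KJ * x IKL + x KI * x JKL) / x KL"
    unfolding y \<pi>_e by (simp del: quad_embed.simps add: s4 s3 s2 s1 e_iff)
  have yB: "y (?e IJL) = (x LI * x JKL + x LJ * x IKL) / x LK"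
    unfolding y \<pi>_e by (simp del: quad_embed.simps add: s4 s3 s2 s1 e_iff x_def)
  have yC: "y (?e IJ) = (x IL * y (?e IJK) + x IK * y (?e IJL)) / x IKL"
    unfolding y \<pi>_e by (simp del: quad_embed.simps add: s4 s3 s2 s1 e_iff x_def)
  have yD: "y (?e JI) = (x JK * y (?e IJL) + x JL * y (?e IJK)) / x JKL"
    unfolding y \<pi>_e by (simp del: quad_embed.simps add: s4 s3 s2 s1 e_iff x_def)
  show "y (Face {|i, j, k|}) = (x KJ * x IKL + x KI * x JKL) / x KL"
    using yA by simp
  show "y (Face {|i, j, l|}) = (x LI * x JKL + x LJ * x IKL) / x LK"
    using yB by simp
  show "y (Edge i j) = (x IL * y (Face {|i, j, k|}) + x IK * y (Face {|i, j, l|})) / x IKL"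
    using yC by simp
  show "y (Edge j i) = (x JK * y (Face {|i, j, l|}) + x JL * y (Face {|i, j, k|})) / x JKL"
    using yD by simp
  show "y u = var s u" if u: "\<And>a. flip_node a \<noteq> a \<Longrightarrow> u \<noteq> ?e a" for u
    using u[of KL] u[of LK] u[of IKL] u[of JKL]
    by (simp del: quad_embed.simps add: y \<pi>_other[OF u] s4 s3 s2 s1)
  show "exch (flip_seed i j k l s) = (\<lambda>u w. R u w + transport ?e flipped_quad u w)"
  proof (intro ext)
    fix u w
    have \<pi>_R: "R (\<pi> u) (\<pi> w) = R u w" for u w
    proof (cases "\<exists>a. flip_node a \<noteq> a \<and> (u = ?e a \<or> w = ?e a)")
      case True
      then obtain a where a: "flip_node a \<noteq> a" and uw: "u = ?e a \<or> w = ?e a" by blast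
      have "flip_node (flip_node a) \<noteq> flip_node a" using a by (cases a) simp_all
      with a uw R show ?thesis by (auto simp: \<pi>_e)
    next
      case False
      then have "\<pi> u = u" "\<pi> w = w" by (auto intro!: \<pi>_other)
      then show ?thesis by simp
    qed
    have in_range: "\<pi> v \<in> range ?e \<longleftrightarrow> v \<in> range ?e" for v
    proof (cases "v \<in> range ?e")
      case False
      then have "\<pi> v = v" by (intro \<pi>_other) auto
      then show ?thesis by simp
    qed (auto simp: \<pi>_e)
    have "transport ?e quad4 (\<pi> u) (\<pi> w) = transport ?e flipped_quad u w"
      using e by (auto simp: transport_def in_range \<pi>_e quad_flip[symmetric])
    then show "exch (flip_seed i j k l s) u w = R u w + transport ?e flipped_quad u w"
      by (simp add: flip rename_nodes_def s4 \<pi>_R)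
  qed
qed

section \<open>Noncrossing segments and the quiver of a triangulation\<close>

lemma crossingI:
  assumes "a < b" "b < a'" "a' < b'"
  shows "crossing {a, a'} {b, b'}" "crossing {b, b'} {a, a'}"
  using assms unfolding crossing_def by blast+

text \<open>
  The definition of crossing breaks the rotational symmetry of the polygon by using the linear order
  of the vertices. Cyclic order restores it, so that one configuration of four points stands for all of its
  rotations.
\<close>

lemma crossing_iff_clockwise:
  "crossing {a, c} {b, d} \<longleftrightarrow>
    clockwise a b c \<and> clockwise c d a \<or> clockwise a d c \<and> clockwise c b a" (is "_ = ?C")
proof -
  have "crossing {a, c} {b, d} \<longleftrightarrow>
      a < b \<and> b < c \<and> c < d \<or> a < d \<and> d < c \<and> c < b \<or> c < b \<and> b < a \<and> a < d \<or> c < d \<and> d < a \<and> a < b \<or>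
      b < a \<and> a < d \<and> d < c \<or> b < c \<and> c < d \<and> d < a \<or> d < a \<and> a < b \<and> b < c \<or> d < c \<and> c < b \<and> b < a"
    (is "_ \<longleftrightarrow> ?R")
  proof
    show ?R if "crossing {a, c} {b, d}"
      using that unfolding crossing_def doubleton_eq_iff by (elim exE conjE disjE) simp_all
    show "crossing {a, c} {b, d}" if ?R
      using that crossingI[of a b c d] crossingI[of a d c b] crossingI[of c b a d] crossingI[of c d a b]
        crossingI[of b a d c] crossingI[of b c d a] crossingI[of d a b c] crossingI[of d c b a]
      by (elim disjE) (simp_all add: insert_commute)
  qed
  also have "?R \<longleftrightarrow> ?C"
    unfolding clockwise_def by (smt (verit) order.strict_trans order.asym)
  finally show ?thesis .
qed

lemma crossing_sym: "crossing d e \<Longrightarrow> crossing e d"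
  unfolding crossing_def by blast

lemma clockwise_rotate: "clockwise a b c \<longleftrightarrow> clockwise b c a"
  by (auto simp: clockwise_def)

definition noncrossing :: "nat set set \<Rightarrow> bool" where
  "noncrossing T \<longleftrightarrow> (\<forall>d \<in> T. \<forall>e \<in> T. \<not> crossing d e)"

lemma noncrossing_pairs:
  assumes "noncrossing T" "{a, c} \<in> T" "{b, d} \<in> T"
  shows "\<not> (clockwise a b c \<and> clockwise c d a)"
  using assms unfolding noncrossing_def by (metis crossing_iff_clockwise)

lemma clockwise_total:
  "a \<noteq> b \<Longrightarrow> b \<noteq> c \<Longrightarrow> a \<noteq> c \<Longrightarrow> clockwise a b c \<or> clockwise a c b"
  unfolding clockwise_def
    by (smt (verit) order.strict_trans order.asym nat_neq_iff)

lemma clockwise_distinct: "clockwise a b c \<Longrightarrow> a \<noteq> b \<and> b \<noteq> c \<and> a \<noteq> c"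
  by (auto simp: clockwise_def)

lemma clockwise_asym: "clockwise a b c \<Longrightarrow> \<not> clockwise a c b"
  by (auto simp: clockwise_def)

definition corner_arrows :: "nat \<Rightarrow> nat \<Rightarrow> nat \<Rightarrow> (node \<times> node) set" where
  "corner_arrows p t b =
    {(Edge p t, Face {|p, t, b|}), (Face {|p, t, b|}, Edge p b), (Edge p b, Edge p t)}"

lemma arrow_iff_corner:
  "arrow T u v \<longleftrightarrow> (\<exists>p t b. clockwise p t b \<and> is_triangle T p t b \<and> (u, v) \<in> corner_arrows p t b)"
  by (auto simp: arrow_def corner_arrows_def)

fun node_vertices :: "node \<Rightarrow> nat set" where
  "node_vertices (Edge i j) = {i, j}"
| "node_vertices (Face F) = fset F"

lemma corner_arrows_vertices:
  "(u, v) \<in> corner_arrows p t b \<Longrightarrow> node_vertices u \<subseteq> {p, t, b} \<and> node_vertices v \<subseteq> {p, t, b}"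
  by (auto simp: corner_arrows_def)

lemma corner_arrows_triangle:
  assumes "(u, v) \<in> corner_arrows p t b" "p \<noteq> t" "t \<noteq> b" "p \<noteq> b"
  shows "node_vertices u \<union> node_vertices v = {p, t, b}"
  using assms by (auto simp: corner_arrows_def)

text \<open>
  The arrows from those triangles that do not have the diagonal \<open>d\<close> as a side. They are the part of
  the quiver that a flip of \<open>d\<close> leaves alone.
\<close>

definition arrow_off :: "nat set set \<Rightarrow> nat set \<Rightarrow> node \<Rightarrow> node \<Rightarrow> bool" where
  "arrow_off T d u v \<longleftrightarrow> (\<exists>p t b. clockwise p t b \<and> is_triangle T p t b \<and> \<not> d \<subseteq> {p, t, b} \<and>
     (u, v) \<in> corner_arrows p t b)"

lemma triangle_permute:
  "is_triangle T a b c \<Longrightarrow> is_triangle T a c b" "is_triangle T a b c \<Longrightarrow> is_triangle T b c a"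
  by (auto simp: is_triangle_def insert_commute)

text \<open>
  A diagonal \<open>kl\<close> of a noncrossing set together with the two triangles on it. The clockwise order
  \<open>k, i, l, j\<close> of the corners is a choice of names for the ends of the diagonal, by
  \<open>quadrilateral_cases\<close> below. Flipping yields a quadrilateral of the same kind, with diagonal
  \<open>ij\<close> (\<open>quadrilateral_flipped\<close>), so facts on triangles and arrows are proved only once and
  then used on both sides of the flip.
\<close>

locale quadrilateral =
  fixes T :: "nat set set" and i j k l :: nat
  assumes noncrossing: "noncrossing T"
    and ikl: "is_triangle T i k l" and jkl: "is_triangle T j k l"
    and kil: "clockwise k i l" and klj: "clockwise k l j"
begin

abbreviation "flipped \<equiv> insert {i, j} (T - {{k, l}})"

lemma distinct: "distinct [i, j, k, l]"
  using kil klj by (auto simp: clockwise_def)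

lemma sides_mem: "{i, k} \<in> T" "{i, l} \<in> T" "{j, k} \<in> T" "{j, l} \<in> T" "{k, l} \<in> T"
  "{k, i} \<in> T" "{l, i} \<in> T" "{k, j} \<in> T" "{l, j} \<in> T" "{l, k} \<in> T"
  using ikl jkl by (auto simp: is_triangle_def insert_commute)

lemma ij_notin: "{i, j} \<notin> T"
  using noncrossing_pairs[OF noncrossing sides_mem(5), of i j] kil klj clockwise_rotate by blast

text \<open>
  A third triangle on \<open>kl\<close> would have its apex on the same side of \<open>kl\<close> as \<open>i\<close> or \<open>j\<close>, and two
  nested triangles with a common base have crossing sides.
\<close>

lemma triangle_on_diagonal:
  assumes "is_triangle T p k l" shows "p = i \<or> p = j"
proof (rule ccontr)
  assume neq: "\<not> (p = i \<or> p = j)"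
  have p: "p \<noteq> k" "p \<noteq> l" "{p, k} \<in> T" "{p, l} \<in> T"
    using assms by (auto simp: is_triangle_def)
  have *: "\<not> crossing {p, k} {i, l}" "\<not> crossing {p, l} {i, k}" "\<not> crossing {p, k} {j, l}" "\<not> crossing {p, l} {j, k}"
    using noncrossing p sides_mem by (auto simp: noncrossing_def)
  show False
    using * neq p(1,2) kil klj unfolding crossing_iff_clockwise clockwise_def
    by (smt (verit) order.strict_trans order.asym nat_neq_iff)
qed

text \<open>
  A segment that meets the diagonal \<open>ij\<close> must leave the quadrilateral through one of its sides,
  unless it is the other diagonal.
\<close>

lemma noncrossing_flipped: "noncrossing flipped"
proof -
  have *: "\<not> crossing d {i, j}" if d: "d \<in> T" "d \<noteq> {k, l}" for d
  proof
    assume c: "crossing d {i, j}"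
    then obtain a b where ab: "d = {a, b}" unfolding crossing_def by blast
    have n: "\<not> crossing {a, b} {i, k}" "\<not> crossing {a, b} {i, l}" "\<not> crossing {a, b} {j, k}" "\<not> crossing {a, b} {j, l}"
      using noncrossing d ab sides_mem by (auto simp: noncrossing_def)
    have ne: "\<not> (a = k \<and> b = l)" "\<not> (a = l \<and> b = k)"
      using d ab by auto
    show False
      using n ne c kil klj unfolding ab crossing_iff_clockwise clockwise_def
    by (smt (verit) order.strict_trans order.asym nat_neq_iff)
  qed
  have "\<not> crossing {i, j} {i, j}"
    by (auto simp: crossing_iff_clockwise clockwise_def)
  with * noncrossing show ?thesis
    unfolding noncrossing_def by (metis DiffE crossing_sym insertE singletonI)
qed

lemma quadrilateral_flipped: "quadrilateral flipped l k i j"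
proof
  show "noncrossing flipped" by (rule noncrossing_flipped)
  show "is_triangle flipped l i j" "is_triangle flipped k i j"
    using distinct sides_mem unfolding is_triangle_def by (auto simp: doubleton_eq_iff)
  show "clockwise i l j" "clockwise i j k"
    using kil klj by (auto simp: clockwise_def)
qed

lemma triangle_flipped_iff:
  "is_triangle flipped p t b \<and> \<not> {i, j} \<subseteq> {p, t, b} \<longleftrightarrow>
   is_triangle T p t b \<and> \<not> {k, l} \<subseteq> {p, t, b}"
  using ij_notin distinct unfolding is_triangle_def by (auto simp: doubleton_eq_iff insert_commute)

lemma arrow_off_flipped: "arrow_off flipped {i, j} = arrow_off T {k, l}"
proof (intro ext)
  fix u v
  have "clockwise p t b \<and> is_triangle flipped p t b \<and> \<not> {i, j} \<subseteq> {p, t, b} \<and> (u, v) \<in> corner_arrows p t b \<longleftrightarrow>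
      clockwise p t b \<and> is_triangle T p t b \<and> \<not> {k, l} \<subseteq> {p, t, b} \<and> (u, v) \<in> corner_arrows p t b"
    for p t b
    using triangle_flipped_iff[of p t b] by argo
  then show "arrow_off flipped {i, j} u v = arrow_off T {k, l} u v"
    unfolding arrow_off_def by simp
qed

abbreviation "e \<equiv> quad_embed i j k l"

lemma diagonal_triangles:
  "clockwise p t b \<and> is_triangle T p t b \<and> {k, l} \<subseteq> {p, t, b} \<longleftrightarrow>
   (p, t, b) \<in> {(k, i, l), (i, l, k), (l, k, i), (k, l, j), (l, j, k), (j, k, l)}"
proof
  assume A: "clockwise p t b \<and> is_triangle T p t b \<and> {k, l} \<subseteq> {p, t, b}"
  then have T: "is_triangle T p t b" by simp
  have "t = k \<and> b = l \<or> t = l \<and> b = k \<or> p = k \<and> b = l \<or> p = l \<and> b = k \<or> p = k \<and> t = l \<or> p = l \<and> t = k"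
    using A distinct by auto
  moreover have "(t = k \<and> b = l \<or> t = l \<and> b = k) \<longrightarrow> p = i \<or> p = j"
    "(p = k \<and> b = l \<or> p = l \<and> b = k) \<longrightarrow> t = i \<or> t = j"
    "(p = k \<and> t = l \<or> p = l \<and> t = k) \<longrightarrow> b = i \<or> b = j"
    using T triangle_on_diagonal triangle_permute by blast+
  moreover have "clockwise p t b" using A by simp
  ultimately show "(p, t, b) \<in> {(k, i, l), (i, l, k), (l, k, i), (k, l, j), (l, j, k), (j, k, l)}"
    using kil klj clockwise_rotate clockwise_asym by (elim disjE conjE; simp) metis+
next
  assume "(p, t, b) \<in> {(k, i, l), (i, l, k), (l, k, i), (k, l, j), (l, j, k), (j, k, l)}"
  with kil klj ikl jkl show "clockwise p t b \<and> is_triangle T p t b \<and> {k, l} \<subseteq> {p, t, b}"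
    by (auto simp: clockwise_def is_triangle_def insert_commute)
qed

lemma arrow_iff_quad:
  "arrow T u v \<longleftrightarrow> arrow_off T {k, l} u v \<or> (u, v) \<in> map_prod e e ` set quad_arrows"
proof -
  define C where "C = {(k, i, l), (i, l, k), (l, k, i), (k, l, j), (l, j, k), (j, k, l)}"
  note tri = diagonal_triangles[folded C_def]
  have F: "{|k, i, l|} = {|i, k, l|}" "{|i, l, k|} = {|i, k, l|}" "{|l, k, i|} = {|i, k, l|}"
    "{|k, l, j|} = {|j, k, l|}" "{|l, j, k|} = {|j, k, l|}"
    by auto
  have "(\<Union>(p, t, b) \<in> C. corner_arrows p t b) = map_prod e e ` set quad_arrows"
    unfolding C_def corner_arrows_def quad_arrows_def
    by (simp only: UN_insert UN_empty list.set image_insert image_empty map_prod_simp prod.case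
      quad_embed.simps F Un_insert_left Un_empty_left Union_insert Union_empty Un_empty_right)
  then have "(u, v) \<in> map_prod e e ` set quad_arrows \<longleftrightarrow> (\<exists>p t b. (p, t, b) \<in> C \<and> (u, v) \<in> corner_arrows p t b)"
    by (simp only: flip: \<open>_ = map_prod e e ` set quad_arrows\<close>) auto
  then show ?thesis
    unfolding arrow_iff_corner arrow_off_def tri[symmetric] by blast
qed

text \<open>
  An arrow determines its triangle, as the end points of its two nodes are the three corners.
\<close>

lemma arrow_off_disjoint:
  "arrow_off T {k, l} u v \<Longrightarrow> (u, v) \<notin> map_prod e e ` set quad_arrows"
proof
  assume "arrow_off T {k, l} u v" and q: "(u, v) \<in> map_prod e e ` set quad_arrows"
  then obtain p t b where "clockwise p t b" "\<not> {k, l} \<subseteq> {p, t, b}" "(u, v) \<in> corner_arrows p t b"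
    unfolding arrow_off_def by blast
  then have "\<not> {k, l} \<subseteq> node_vertices u \<union> node_vertices v"
    using corner_arrows_triangle clockwise_distinct by metis
  with q show False
    unfolding quad_arrows_def by auto
qed

lemma exch_initial_seed_quad:
  "exch (initial_seed T) u v =
     of_bool (arrow_off T {k, l} u v) - of_bool (arrow_off T {k, l} v u) + transport e quad0 u v"
proof -
  have inj: "inj e" by (rule inj_quad_embed[OF distinct])
  have "transport e quad0 u v =
      of_bool ((u, v) \<in> map_prod e e ` set quad_arrows) - of_bool ((v, u) \<in> map_prod e e ` set quad_arrows)"
    unfolding quad0_def by (rule transport_arrows_matrix[OF inj])
  moreover have "of_bool (arrow T u v) = (of_bool (arrow_off T {k, l} u v) :: int) +
      of_bool ((u, v) \<in> map_prod e e ` set quad_arrows)" for u v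
    using arrow_iff_quad arrow_off_disjoint by (simp add: of_bool_def)
  ultimately show ?thesis
    by (simp add: initial_seed_def)
qed

lemma arrow_off_quad:
  assumes "flip_node a \<noteq> a"
  shows "\<not> arrow_off T {k, l} (e a) u" "\<not> arrow_off T {k, l} u (e a)"
proof -
  have a: "{k, l} \<subseteq> node_vertices (e a) \<or> {i, j} \<subseteq> node_vertices (e a)"
    using assms by (cases a) auto
  have "\<not> {i, j} \<subseteq> {p, t, b}" if "is_triangle T p t b" for p t b
    using that ij_notin distinct by (auto simp: is_triangle_def insert_commute)
  with a show "\<not> arrow_off T {k, l} (e a) u" "\<not> arrow_off T {k, l} u (e a)"
    unfolding arrow_off_def using corner_arrows_vertices by (meson subset_trans)+
qed

end

lemma map_quad_arrows_flipped:
  "map_prod (quad_embed l k i j) (quad_embed l k i j) ` set quad_arrows =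
   map_prod (quad_embed i j k l) (quad_embed i j k l) ` set flipped_quad_arrows"
proof -
  have F: "{|l, i, j|} = {|i, j, l|}" "{|k, i, j|} = {|i, j, k|}" "{|k, j, i|} = {|i, j, k|}" "{|l, j, i|} = {|i, j, l|}"
    "{|l, k, i|} = {|i, k, l|}" "{|l, k, j|} = {|j, k, l|}"
    by auto
  show ?thesis
    unfolding quad_arrows_def flipped_quad_arrows_def
    by (simp only: list.set image_insert image_empty map_prod_simp quad_embed.simps F)
qed

context quadrilateral
begin

text \<open>
  This is the decomposition \<open>exch_initial_seed_quad\<close> for the flipped quadrilateral, with its
  nodes named as before the flip.
\<close>

lemma exch_initial_seed_flipped:
  "exch (initial_seed flipped) u v =
     of_bool (arrow_off T {k, l} u v) - of_bool (arrow_off T {k, l} v u) + transport e flipped_quad u v"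
proof -
  interpret f: quadrilateral flipped l k i j by (rule quadrilateral_flipped)
  have "transport f.e quad0 = transport e flipped_quad"
    unfolding quad0_def flipped_quad_def fun_eq_iff
    by (simp only: transport_arrows_matrix[OF inj_quad_embed[OF distinct]]
      transport_arrows_matrix[OF inj_quad_embed[OF f.distinct]] map_quad_arrows_flipped simp_thms)
  then show ?thesis
    unfolding f.exch_initial_seed_quad arrow_off_flipped by simp
qed

end

section \<open>Subtraction-free elements\<close>

definition nonneg_coeffs :: "laurent \<Rightarrow> bool" where
  "nonneg_coeffs p \<longleftrightarrow> (\<forall>m. Poly_Mapping.lookup p m \<ge> 0)"

lemma nonneg_coeffs_mult:
  assumes "nonneg_coeffs p" "nonneg_coeffs q" shows "nonneg_coeffs (p * q)"
  unfolding nonneg_coeffs_def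
proof
  fix m
  show "Poly_Mapping.lookup (p * q) m \<ge> 0"
    using assms unfolding nonneg_coeffs_def times_poly_mapping.rep_eq prod_fun_def
    by (auto simp: Sum_any.expand_set when_def intro!: sum_nonneg mult_nonneg_nonneg)
qed

lemma nonneg_coeffs_add:
  assumes "nonneg_coeffs p" "nonneg_coeffs q" "p \<noteq> 0"
  shows "nonneg_coeffs (p + q)" "p + q \<noteq> 0"
proof -
  show "nonneg_coeffs (p + q)"
    using assms by (simp add: nonneg_coeffs_def lookup_add)
  from \<open>p \<noteq> 0\<close> obtain m where "Poly_Mapping.lookup p m \<noteq> 0"
    by (metis lookup_zero poly_mapping_eqI)
  with assms have "Poly_Mapping.lookup (p + q) m > 0"
    unfolding nonneg_coeffs_def lookup_add by (metis add_pos_nonneg order_less_le)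
  then show "p + q \<noteq> 0" by auto
qed

text \<open>
  Cluster variables are divided by in a mutation, so they must be known to be nonzero. Since
  exchange relations involve no subtraction, all of them are quotients of nonzero Laurent
  polynomials with nonnegative coefficients.
\<close>

definition subtraction_free :: "laurent fract \<Rightarrow> bool" where
  "subtraction_free x \<longleftrightarrow> (\<exists>p q. nonneg_coeffs p \<and> p \<noteq> 0 \<and> nonneg_coeffs q \<and> q \<noteq> 0 \<and>
     x = to_fract p / to_fract q)"

lemma subtraction_free_nonzero: "subtraction_free x \<Longrightarrow> x \<noteq> 0"
  by (auto simp: subtraction_free_def)

lemma subtraction_free_mult:
  assumes "subtraction_free x" "subtraction_free y" shows "subtraction_free (x * y)"
proof -
  from assms obtain p q p' q' where
    "nonneg_coeffs p" "p \<noteq> 0" "nonneg_coeffs q" "q \<noteq> 0" "x = to_fract p / to_fract q"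
    "nonneg_coeffs p'" "p' \<noteq> 0" "nonneg_coeffs q'" "q' \<noteq> 0" "y = to_fract p' / to_fract q'"
    unfolding subtraction_free_def by blast
  then show ?thesis
    unfolding subtraction_free_def
    by (intro exI[of _ "p * p'"] exI[of _ "q * q'"]) (simp add: nonneg_coeffs_mult)
qed

lemma subtraction_free_divide:
  assumes "subtraction_free x" "subtraction_free y" shows "subtraction_free (x / y)"
proof -
  from \<open>subtraction_free y\<close> have "subtraction_free (1 / y)"
    unfolding subtraction_free_def by (metis divide_divide_eq_right mult_1 divide_divide_eq_right)
  then show ?thesis
    using subtraction_free_mult[OF assms(1), of "1 / y"] by simp
qed

lemma subtraction_free_add:
  assumes "subtraction_free x" "subtraction_free y" shows "subtraction_free (x + y)"
proof -
  from assms obtain p q p' q' where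
    "nonneg_coeffs p" "p \<noteq> 0" "nonneg_coeffs q" "q \<noteq> 0" "x = to_fract p / to_fract q"
    "nonneg_coeffs p'" "p' \<noteq> 0" "nonneg_coeffs q'" "q' \<noteq> 0" "y = to_fract p' / to_fract q'"
    unfolding subtraction_free_def by blast
  then show ?thesis
    unfolding subtraction_free_def
    by (intro exI[of _ "p * q' + p' * q"] exI[of _ "q * q'"])
       (simp add: nonneg_coeffs_mult nonneg_coeffs_add add_frac_eq)
qed

lemma nonneg_coeffs_single: "c \<ge> 0 \<Longrightarrow> nonneg_coeffs (Poly_Mapping.single m c)"
  by (auto simp: nonneg_coeffs_def lookup_single when_def)

lemma subtraction_free_indeterminate: "subtraction_free (indeterminate v)"
proof -
  have "nonneg_coeffs 1"
    using nonneg_coeffs_single[of 1 0] by simp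
  then show ?thesis
    unfolding subtraction_free_def indeterminate_def
    by (intro exI[of _ "Poly_Mapping.single (Poly_Mapping.single v 1) 1"] exI[of _ 1])
       (simp add: nonneg_coeffs_single)
qed

lemma indeterminate_nonzero: "indeterminate v \<noteq> 0"
  by (rule subtraction_free_nonzero[OF subtraction_free_indeterminate])

lemma subtraction_free_one: "subtraction_free 1"
  using subtraction_free_divide[OF subtraction_free_indeterminate subtraction_free_indeterminate]
    subtraction_free_nonzero[OF subtraction_free_indeterminate]
  by (metis divide_self)

lemma subtraction_free_power: "subtraction_free x \<Longrightarrow> subtraction_free (x ^ n)"
  by (induction n) (auto intro: subtraction_free_one subtraction_free_mult)

lemma subtraction_free_prod: "(\<And>a. a \<in> A \<Longrightarrow> subtraction_free (f a)) \<Longrightarrow> subtraction_free (prod f A)"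
  by (induction A rule: infinite_finite_induct) (auto intro: subtraction_free_one subtraction_free_mult)

text \<open>
  A product over infinitely many neighbours is \<open>1\<close> by convention and hence subtraction-free, too.
\<close>

lemma subtraction_free_mutate:
  assumes "\<And>u. subtraction_free (var s u)" shows "subtraction_free (var (mutate v s) u)"
  using assms by (auto simp: var_mutate intro!: subtraction_free_divide subtraction_free_add
    subtraction_free_prod subtraction_free_power)

lemma subtraction_free_flip:
  assumes "\<And>u. subtraction_free (var s u)" shows "subtraction_free (var (flip_seed i j k l s) u)"
  unfolding flip_seed_def rename_nodes_def using assms by (auto intro!: subtraction_free_mutate)

section \<open>Flips preserve flag coordinates\<close>

text \<open>
  The coordinates of a configuration of affine flags \<open>(v\<^sub>i, \<xi>\<^sub>i)\<close>, where the covector \<open>\<xi>\<^sub>i\<close> kills the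
  vector \<open>v\<^sub>i\<close>: \<open>X i j = \<xi>\<^sub>i(v\<^sub>j)\<close> and \<open>D i j k = det(v\<^sub>i, v\<^sub>j, v\<^sub>k)\<close>. The equation \<open>exchange\<close> is the
  linear dependence between \<open>v\<^sub>k, v\<^sub>i, v\<^sub>l, v\<^sub>j\<close> given by Cramer's rule, with \<open>\<xi>\<^sub>k\<close> applied to it.
\<close>

locale flag_coordinates =
  fixes X :: "nat \<Rightarrow> nat \<Rightarrow> 'f::field" and D :: "nat \<Rightarrow> nat \<Rightarrow> nat \<Rightarrow> 'f"
  assumes cyclic: "D a b c = D b c a"
    and exchange: "X k l * D k i j = X k i * D k l j + X k j * D k i l"
begin

definition matches :: "nat set set \<Rightarrow> (node, 'f) seed \<Rightarrow> bool" where
  "matches T s \<longleftrightarrow> (\<forall>a b. a \<noteq> b \<longrightarrow> {a, b} \<in> T \<longrightarrow> var s (Edge a b) = X a b) \<and>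
    (\<forall>a b c. clockwise a b c \<longrightarrow> is_triangle T a b c \<longrightarrow> var s (Face {|a, b, c|}) = D a b c)"

end

locale quadrilateral_flags = quadrilateral T i j k l + flag_coordinates X D
  for T i j k l and X :: "nat \<Rightarrow> nat \<Rightarrow> 'f::field" and D
begin

text \<open>
  Each of the four exchange relations of a flip is the equation \<open>exchange\<close> at one of the four
  corners, so the new variables are flag coordinates because the old ones are.
\<close>

lemma flip_seed_invariant:
  assumes exch_s: "exch s = exch (initial_seed T)" and s: "matches T s"
    and nonzero: "\<And>u. var s u \<noteq> 0"
  shows "exch (flip_seed i j k l s) = exch (initial_seed flipped)"
    and "matches flipped (flip_seed i j k l s)"
proof -
  define R where "R u v = (of_bool (arrow_off T {k, l} u v) - of_bool (arrow_off T {k, l} v u) :: int)" for u v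
  let ?y = "var (flip_seed i j k l s)"
  have exch_s': "exch s = (\<lambda>u w. R u w + transport e quad0 u w)"
    unfolding exch_s exch_initial_seed_quad[abs_def] R_def fun_eq_iff by blast
  have R: "\<And>a u. flip_node a \<noteq> a \<Longrightarrow> R (e a) u = 0" "\<And>a u. flip_node a \<noteq> a \<Longrightarrow> R u (e a) = 0"
    by (simp_all add: R_def arrow_off_quad)
  note flip = flip_seed_quad[OF distinct exch_s' R]
  show "exch (flip_seed i j k l s) = exch (initial_seed flipped)"
    using flip(1) by (simp add: fun_eq_iff exch_initial_seed_flipped R_def)
  have edge: "var s (Edge a b) = X a b" if "{a, b} \<in> T" "a \<noteq> b" for a b
    using s that by (simp add: matches_def)
  have face: "var s (Face {|i, k, l|}) = D k i l" "var s (Face {|j, k, l|}) = D k l j"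
  proof -
    have "{|i, k, l|} = {|k, i, l|}" "{|j, k, l|} = {|k, l, j|}" by auto
    then show "var s (Face {|i, k, l|}) = D k i l" "var s (Face {|j, k, l|}) = D k l j"
      using s kil klj ikl jkl triangle_permute unfolding matches_def by metis+
  qed
  have X: "var s (Edge k i) = X k i" "var s (Edge i k) = X i k" "var s (Edge i l) = X i l" "var s (Edge l i) = X l i"
    "var s (Edge l j) = X l j" "var s (Edge j l) = X j l" "var s (Edge j k) = X j k" "var s (Edge k j) = X k j"
    "var s (Edge k l) = X k l" "var s (Edge l k) = X l k"
    using distinct sides_mem by (simp_all add: edge)
  have nz: "X k l \<noteq> 0" "X l k \<noteq> 0" "D k i l \<noteq> 0" "D k l j \<noteq> 0"
    using nonzero[of "Edge k l"] nonzero[of "Edge l k"] nonzero[of "Face {|i, k, l|}"] nonzero[of "Face {|j, k, l|}"]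
    by (simp_all add: X face)
  have ijk: "?y (Face {|i, j, k|}) = D k i j"
    using exchange[of k l i j] nz by (simp add: flip(2) X face divide_eq_eq algebra_simps)
  have ijl: "?y (Face {|i, j, l|}) = D i l j"
    using exchange[of l k j i] cyclic[of l j i] cyclic[of j i l] cyclic[of l k i] cyclic[of l j k] cyclic[of j k l] nz
    by (simp add: flip(3) X face divide_eq_eq algebra_simps)
  have ij: "?y (Edge i j) = X i j"
    using exchange[of i j l k] cyclic[of k i l] cyclic[of k i j] nz
    by (simp add: flip(4) X face ijk ijl divide_eq_eq algebra_simps)
  have ji: "?y (Edge j i) = X j i"
    using exchange[of j i k l] cyclic[of k l j] cyclic[of l j k] cyclic[of k i j] cyclic[of i j k]
      cyclic[of i l j] cyclic[of l j i] nz
    by (simp add: flip(5) X face ijk ijl divide_eq_eq algebra_simps)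
  have other: "?y u = var s u" if "\<not> {k, l} \<subseteq> node_vertices u" "\<not> {i, j} \<subseteq> node_vertices u" for u
  proof (rule flip(6))
    fix a assume "flip_node a \<noteq> a"
    then show "u \<noteq> e a" using that by (cases a) auto
  qed
  interpret f: quadrilateral flipped l k i j by (rule quadrilateral_flipped)
  show "matches flipped (flip_seed i j k l s)"
    unfolding matches_def
  proof (intro conjI allI impI)
    fix a b assume ab: "a \<noteq> b" "{a, b} \<in> flipped"
    show "?y (Edge a b) = X a b"
    proof (cases "{a, b} = {i, j}")
      case True
      then show ?thesis using ij ji by (auto simp: doubleton_eq_iff)
    next
      case False
      with ab have "{a, b} \<in> T" "\<not> {k, l} \<subseteq> {a, b}" "\<not> {i, j} \<subseteq> {a, b}"
        using distinct by auto
      with ab show ?thesis by (simp add: other edge)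
    qed
  next
    fix a b c assume abc: "clockwise a b c" "is_triangle flipped a b c"
    show "?y (Face {|a, b, c|}) = D a b c"
    proof (cases "{i, j} \<subseteq> {a, b, c}")
      case True
      have F: "{|i, l, j|} = {|i, j, l|}" "{|l, j, i|} = {|i, j, l|}" "{|j, i, l|} = {|i, j, l|}"
        "{|j, k, i|} = {|i, j, k|}" "{|k, i, j|} = {|i, j, k|}"
        by auto
      have "(a, b, c) \<in> {(i, l, j), (l, j, i), (j, i, l), (i, j, k), (j, k, i), (k, i, j)}"
        by (rule f.diagonal_triangles[THEN iffD1, OF conjI[OF abc(1) conjI[OF abc(2) True]]])
      then show ?thesis
        using ijk ijl cyclic[of i l j] cyclic[of l j i] cyclic[of k i j] cyclic[of i j k]
        by (auto simp: F)
    next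
      case False
      then have "is_triangle T a b c" "\<not> {k, l} \<subseteq> {a, b, c}"
        using triangle_flipped_iff[of a b c] abc(2) by argo+
      moreover have "?y (Face {|a, b, c|}) = var s (Face {|a, b, c|})"
        using False \<open>\<not> {k, l} \<subseteq> {a, b, c}\<close> by (intro other) simp_all
      ultimately show ?thesis
        using s abc by (simp add: matches_def)
    qed
  qed
qed

end

text \<open>
  The definition of a flip mutates first at \<open>kl\<close> and then at \<open>lk\<close>. These nodes are not adjacent, so
  the order is irrelevant and the ends of the diagonal may be exchanged.
\<close>

lemma flip_seed_swap:
  assumes "distinct [i, j, k, l]" "exch s = exch (initial_seed T)"
  shows "flip_seed i j l k s = flip_seed i j k l s"
proof -
  have "\<not> arrow T (Edge k l) (Edge l k)" "\<not> arrow T (Edge l k) (Edge k l)"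
    using assms by (auto simp: arrow_def)
  then have "mutate (Edge k l) (mutate (Edge l k) s) = mutate (Edge l k) (mutate (Edge k l) s)"
    using assms by (intro mutate_commute) (auto simp: initial_seed_def)
  moreover have "transpose (Edge l k) (Face {|i, j, l|}) \<circ> transpose (Edge k l) (Face {|i, j, k|}) =
      transpose (Edge k l) (Face {|i, j, k|}) \<circ> transpose (Edge l k) (Face {|i, j, l|})"
    using assms by (intro transpose_disjoint_commute) (auto simp: fset_eq_iff)
  moreover have "{|j, l, k|} = {|j, k, l|}" "{|i, l, k|} = {|i, k, l|}"
    by auto
  ultimately show ?thesis
    by (simp add: flip_seed_def)
qed

text \<open>
  If \<open>i\<close> and \<open>j\<close> were on the same side of \<open>kl\<close>, then sides of the two triangles would cross.
\<close>

lemma quadrilateral_cases: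
  assumes "noncrossing T" "is_triangle T i k l" "is_triangle T j k l" "i \<noteq> j"
  shows "quadrilateral T i j k l \<or> quadrilateral T i j l k"
proof -
  have d: "k \<noteq> l" "i \<noteq> k" "i \<noteq> l" "j \<noteq> k" "j \<noteq> l"
    using assms by (auto simp: is_triangle_def)
  have "{i, k} \<in> T" "{i, l} \<in> T" "{j, k} \<in> T" "{j, l} \<in> T"
    using assms by (auto simp: is_triangle_def insert_commute)
  then have n: "\<not> crossing {i, k} {j, l}" "\<not> crossing {i, l} {j, k}"
    using assms(1) by (auto simp: noncrossing_def)
  have "clockwise k i l \<and> clockwise k l j \<or> clockwise l i k \<and> clockwise l k j"
    using n d assms(4) unfolding crossing_iff_clockwise clockwise_def
    by (smt (verit) order.strict_trans order.asym nat_neq_iff)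
  then show ?thesis
    using assms triangle_permute unfolding quadrilateral_def by metis
qed

lemma is_triangle_iff_set:
  "is_triangle T a b c \<longleftrightarrow>
    card {a, b, c} = 3 \<and> (\<forall>x \<in> {a, b, c}. \<forall>y \<in> {a, b, c}. x \<noteq> y \<longrightarrow> {x, y} \<in> T)"
  by (auto simp: is_triangle_def insert_commute card_insert_if)

context
  fixes X :: "nat \<Rightarrow> nat \<Rightarrow> laurent fract" and D \<Delta>
  assumes flags: "flag_coordinates X D"
    and noncrossing_\<Delta>: "noncrossing \<Delta>"
    and matches_initial: "flag_coordinates.matches X D \<Delta> (initial_seed \<Delta>)"
begin

interpretation flag_coordinates X D by (rule flags)

lemma flip_reachable_invariant:
  assumes "flip_reachable \<Delta> T s"
  shows "noncrossing T \<and> exch s = exch (initial_seed T) \<and> matches T s \<and> (\<forall>u. subtraction_free (var s u))"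
  using assms
proof induction
  case initial
  have "var (initial_seed \<Delta>) = indeterminate"
    by (simp add: initial_seed_def)
  then show ?case
    using noncrossing_\<Delta> matches_initial by (simp add: subtraction_free_indeterminate)
next
  case (flip T s i k l j)
  have flip_T: "noncrossing (insert {i, j} (T - {{k, l}})) \<and>
      exch (flip_seed i j k l s) = exch (initial_seed (insert {i, j} (T - {{k, l}}))) \<and>
      matches (insert {i, j} (T - {{k, l}})) (flip_seed i j k l s)"
    if "quadrilateral T i j k l" for k l
  proof -
    interpret quadrilateral T i j k l by (rule that)
    interpret quadrilateral_flags T i j k l X D ..
    show ?thesis
      using flip.IH subtraction_free_nonzero noncrossing_flipped flip_seed_invariant[of s] by blast
  qed
  have "noncrossing (insert {i, j} (T - {{k, l}})) \<and>
      exch (flip_seed i j k l s) = exch (initial_seed (insert {i, j} (T - {{k, l}}))) \<and>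
      matches (insert {i, j} (T - {{k, l}})) (flip_seed i j k l s)"
    using quadrilateral_cases[of T i k l j]
  proof
    show "noncrossing T" "is_triangle T i k l" "is_triangle T j k l" "i \<noteq> j"
      using flip by auto
  next
    assume "quadrilateral T i j k l"
    then show ?thesis by (rule flip_T)
  next
    assume q: "quadrilateral T i j l k"
    have "flip_seed i j l k s = flip_seed i j k l s"
      using flip.IH quadrilateral.distinct[OF q] by (intro flip_seed_swap) auto
    with flip_T[OF q] show ?thesis by (simp add: insert_commute)
  qed
  then show ?case
    using flip.IH by (auto intro: subtraction_free_flip)
qed

text \<open>
  By the invariant every seed containing the face has the same variable there, which makes the
  definite description meaningful.
\<close>

lemma face_variable_eq:
  assumes "flip_reachable \<Delta> T s" "is_triangle T a b c" "clockwise a b c"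
  shows "face_variable \<Delta> {|a, b, c|} = D a b c"
  unfolding face_variable_def
proof (rule the_equality)
  show "\<exists>T s. flip_reachable \<Delta> T s \<and> is_face_of T {|a, b, c|} \<and> D a b c = var s (Face {|a, b, c|})"
    using assms flip_reachable_invariant[OF assms(1)] unfolding matches_def is_face_of_def by metis
next
  fix x assume "\<exists>T s. flip_reachable \<Delta> T s \<and> is_face_of T {|a, b, c|} \<and> x = var s (Face {|a, b, c|})"
  then obtain T s where T: "flip_reachable \<Delta> T s" "is_face_of T {|a, b, c|}" "x = var s (Face {|a, b, c|})"
    by blast
  then obtain a' b' c' where abc: "{|a, b, c|} = {|a', b', c'|}" "is_triangle T a' b' c'"
    unfolding is_face_of_def by blast
  have "{a, b, c} = {a', b', c'}"
    using abc(1) by (metis finsert.rep_eq bot_fset.rep_eq)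
  then have "is_triangle T a b c"
    using abc(2) unfolding is_triangle_iff_set by simp
  then show "x = D a b c"
    using T flip_reachable_invariant[OF T(1)] assms(3) by (simp add: matches_def)
qed

end

section \<open>Flags with prescribed coordinates along a fan\<close>

lemma flag_coordinates_of_vectors:
  fixes a b c p q r :: "nat \<Rightarrow> 'f::field"
  assumes "\<And>i. p i * a i + q i * b i + r i * c i = 0"
  shows "flag_coordinates (\<lambda>i j. p i * a j + q i * b j + r i * c j)
    (\<lambda>i j k. a i * (b j * c k - c j * b k) + b i * (c j * a k - a j * c k) + c i * (a j * b k - b j * a k))"
    (is "flag_coordinates ?X ?D")
proof
  show "?D i j k = ?D j k i" for i j k
    by (simp add: algebra_simps)
  fix k l i j
  have "?X k l * ?D k i j = ?X k i * ?D k l j + ?X k j * ?D k i l - ?D i l j * ?X k k"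
    by (simp add: algebra_simps)
  then show "?X k l * ?D k i j = ?X k i * ?D k l j + ?X k j * ?D k i l"
    using assms[of k] by simp
qed

lemma flag_coordinates_pullback:
  "flag_coordinates X D \<Longrightarrow> flag_coordinates (\<lambda>i j. X (h i) (h j)) (\<lambda>i j k. D (h i) (h j) (h k))"
  unfolding flag_coordinates_def by blast

text \<open>
  All flag coordinates along a fan with apex \<open>0\<close> can be prescribed: \<open>E i j\<close> is the value wanted on the
  edge \<open>ij\<close>, and \<open>F i\<close> the value on the triangle \<open>0, i, i + 1\<close>. Up to a change of basis
  \<open>v\<^sub>0 = (1, 0, 0)\<close> and \<open>\<xi>\<^sub>0 = (0, 1, 0)\<close>, so that \<open>\<xi>\<^sub>0(v\<^sub>i) = E 0 i\<close> forces
  \<open>v\<^sub>i = E 0 i * (\<alpha>\<^sub>i, 1, \<beta>\<^sub>i)\<close>, and then \<open>det(v\<^sub>0, v\<^sub>i, v\<^sub>j) = E 0 i * E 0 j * (\<beta>\<^sub>j - \<beta>\<^sub>i)\<close>. The triangles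
  prescribe the increments of \<open>\<beta>\<close>, so the determinant of \<open>v\<^sub>0, v\<^sub>1, v\<^sub>i\<close> is a telescoping sum. The
  points \<open>(\<beta>\<^sub>i, \<alpha>\<^sub>i)\<close> form a polygonal line; the values on the edges \<open>i(i - 1)\<close> and \<open>i(i + 1)\<close>
  together prescribe the change of its slope \<open>\<sigma>\<close> at the point \<open>i\<close>.
\<close>

lemma fan_flags:
  fixes E :: "nat \<Rightarrow> nat \<Rightarrow> 'f::field" and F :: "nat \<Rightarrow> 'f"
  assumes E: "\<And>i j. E i j \<noteq> 0" and F: "\<And>i. F i \<noteq> 0"
  shows "\<exists>X D. flag_coordinates X D \<and> (\<forall>i>0. X 0 i = E 0 i \<and> X i 0 = E i 0 \<and>
    X i (Suc i) = E i (Suc i) \<and> X (Suc i) i = E (Suc i) i \<and> D 0 i (Suc i) = F i \<and>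
    D 0 1 i = E 0 1 * E 0 i * (\<Sum>m = 1..<i. F m / (E 0 m * E 0 (Suc m))))"
proof -
  define d where "d m = F m / (E 0 m * E 0 (Suc m))" for m
  \<comment> \<open>The value on \<open>i(i + 1)\<close> will be \<open>E 0 (i + 1) * d i * (E i 0 * \<sigma> i + r i)\<close> with \<open>r i\<close> the third
     coordinate of \<open>\<xi>\<^sub>i\<close>, so the last factor has to be \<open>g i\<close>.\<close>
  define g where "g i = E i (Suc i) / (E 0 (Suc i) * d i)" for i
  define \<sigma> where "\<sigma> i = (\<Sum>m = 1..<i. (g (Suc m) + E (Suc m) m / (E 0 m * d m)) / E (Suc m) 0)" for i
  define \<alpha> where "\<alpha> i = (\<Sum>m = 1..<i. \<sigma> m * d m)" for i
  define \<beta> where "\<beta> i = (\<Sum>m = 1..<i. d m)" for i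
  define r where "r i = g i - E i 0 * \<sigma> i" for i
  let ?a = "\<lambda>i. if i = 0 then 1 else E 0 i * \<alpha> i"
  let ?b = "\<lambda>i. if i = 0 then 0 else E 0 i"
  let ?c = "\<lambda>i. if i = 0 then 0 else E 0 i * \<beta> i"
  let ?p = "\<lambda>i. if i = 0 then 0 else E i 0"
  let ?q = "\<lambda>i. if i = 0 then 1 else - (E i 0 * \<alpha> i + r i * \<beta> i)"
  let ?r = "\<lambda>i. if i = 0 then 0 else r i"
  let ?X = "\<lambda>i j. ?p i * ?a j + ?q i * ?b j + ?r i * ?c j"
  let ?D = "\<lambda>i j k. ?a i * (?b j * ?c k - ?c j * ?b k) + ?b i * (?c j * ?a k - ?a j * ?c k) +
    ?c i * (?a j * ?b k - ?b j * ?a k)"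
  have d: "d i \<noteq> 0" for i using E F by (simp add: d_def)
  have \<alpha>: "\<alpha> (Suc i) = \<alpha> i + \<sigma> i * d i" and \<beta>: "\<beta> (Suc i) = \<beta> i + d i"
    and \<sigma>: "\<sigma> (Suc i) = \<sigma> i + (g (Suc i) + E (Suc i) i / (E 0 i * d i)) / E (Suc i) 0" if "0 < i" for i
    using that by (simp_all add: \<alpha>_def \<beta>_def \<sigma>_def)
  have flags: "flag_coordinates ?X ?D"
    by (rule flag_coordinates_of_vectors) (simp add: algebra_simps)
  have X0: "?X 0 i = E 0 i \<and> ?X i 0 = E i 0" if "0 < i" for i using that by simp
  have X1: "?X i (Suc i) = E i (Suc i)" if "0 < i" for i
  proof -
    have "?X i (Suc i) = E 0 (Suc i) * ((E i 0 * \<sigma> i + r i) * d i)"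
      using that by (simp add: \<alpha> \<beta> algebra_simps)
    also have "\<dots> = E i (Suc i)"
      using E d by (simp add: r_def g_def)
    finally show ?thesis .
  qed
  have X2: "?X (Suc i) i = E (Suc i) i" if "0 < i" for i
  proof -
    have "?X (Suc i) i = - E 0 i * ((E (Suc i) 0 * \<sigma> i + r (Suc i)) * d i)"
      using that by (simp add: \<alpha> \<beta> algebra_simps)
    also have "E (Suc i) 0 * \<sigma> i + r (Suc i) = - (E (Suc i) i / (E 0 i * d i))"
      using that E by (simp add: r_def \<sigma> distrib_left add_divide_distrib)
    also have "- E 0 i * (- (E (Suc i) i / (E 0 i * d i)) * d i) = E (Suc i) i"
      using E d by simp
    finally show ?thesis .
  qed
  have D: "?D 0 i j = E 0 i * E 0 j * (\<beta> j - \<beta> i)" if "0 < i" "0 < j" for i j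
    using that by (simp add: algebra_simps)
  have D1: "?D 0 i (Suc i) = F i" if "0 < i" for i
    using D[of i "Suc i"] E that by (simp add: \<beta> d_def)
  have D2: "?D 0 1 i = E 0 1 * E 0 i * (\<Sum>m = 1..<i. F m / (E 0 m * E 0 (Suc m)))" if "0 < i" for i
    using D[of 1 i] that by (simp add: \<beta>_def d_def)
  show ?thesis
    by (intro exI[of _ ?X] exI[of _ ?D] conjI allI impI) (fact flags X0[THEN conjunct1] X0[THEN conjunct2] X1 X2 D1 D2)+
qed

section \<open>The combinatorics of the fan\<close>

lemma arrow_asym:
  assumes "arrow T u v" shows "\<not> arrow T v u"
proof
  assume "arrow T v u"
  with assms obtain p t b p' t' b' where *: "clockwise p t b" "(u, v) \<in> corner_arrows p t b"
    "clockwise p' t' b'" "(v, u) \<in> corner_arrows p' t' b'"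
    unfolding arrow_iff_corner by blast
  have "{p, t, b} = {p', t', b'}"
    using corner_arrows_triangle[OF *(2)] corner_arrows_triangle[OF *(4)]
      clockwise_distinct[OF *(1)] clockwise_distinct[OF *(3)] by blast
  then have "t' \<in> {p, t, b}" "b' \<in> {p, t, b}"
    by simp_all
  moreover have "p' = p \<and> (t' = b \<or> b' = t)"
    using * \<open>{p, t, b} = {p', t', b'}\<close> clockwise_distinct[OF *(1)] clockwise_distinct[OF *(3)]
    by (auto simp: corner_arrows_def)
  ultimately have "p' = p \<and> t' = b \<and> b' = t"
    using clockwise_distinct[OF *(1)] clockwise_distinct[OF *(3)] by auto
  with * clockwise_asym show False by blast
qed

lemma lookup_y_hat:
  assumes "finite {(u, v). arrow \<Delta> u v}"
  shows "Poly_Mapping.lookup (y_hat \<Delta> v) u = of_bool (arrow \<Delta> u v) - of_bool (arrow \<Delta> v u)"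
proof -
  have "finite {u. arrow \<Delta> u v}" "finite {u. arrow \<Delta> v u}"
    using finite_subset[OF _ finite_imageI[OF assms, of fst], of "{u. arrow \<Delta> u v}"]
      finite_subset[OF _ finite_imageI[OF assms, of snd], of "{u. arrow \<Delta> v u}"]
    by (force simp: image_iff)+
  then show ?thesis
    by (simp add: y_hat_def lookup_minus lookup_sum lookup_single when_def sum.delta)
qed

locale fan =
  fixes n k :: nat and \<Delta> :: "nat set set"
  assumes fan: "fan_triangulation (n + 3) \<Delta> k"
begin

text \<open>
  The vertices of the polygon, counted clockwise from the apex. The positions run from \<open>0\<close> to
  \<open>n + 2\<close>.
\<close>

definition w :: "nat \<Rightarrow> nat" where "w p = (k + p) mod (n + 3)"

lemma k_less: "k < n + 3"
  using fan by (simp add: fan_triangulation_def)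

lemma w_if: "p < n + 3 \<Longrightarrow> w p = (if k + p < n + 3 then k + p else k + p - (n + 3))"
  using k_less by (simp add: w_def mod_if)

lemma w_0: "w 0 = k"
  using k_less by (simp add: w_def)

lemma w_less: "w p < n + 3"
  by (simp add: w_def)

lemma w_eq_iff: "p < n + 3 \<Longrightarrow> q < n + 3 \<Longrightarrow> w p = w q \<longleftrightarrow> p = q"
  using k_less by (auto simp: w_if)

lemma w_surj:
  assumes "a < n + 3" obtains p where "p < n + 3" "a = w p"
proof
  let ?p = "if k \<le> a then a - k else a + (n + 3) - k"
  show "?p < n + 3" "a = w ?p"
    using assms k_less by (auto simp: w_if)
qed

lemma clockwise_w:
  assumes "p < n + 3" "q < n + 3" "r < n + 3"
  shows "clockwise (w p) (w q) (w r) \<longleftrightarrow> clockwise p q r"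
  using assms k_less by (auto simp: w_if clockwise_def)

lemma \<Delta>_segments: "d \<in> \<Delta> \<Longrightarrow> d \<in> segments (n + 3)"
  using fan by (auto simp: fan_triangulation_def triangulation_def)

lemma \<Delta>_diagonal: "d \<in> \<Delta> \<Longrightarrow> d \<notin> sides (n + 3) \<Longrightarrow> k \<in> d"
  using fan unfolding fan_triangulation_def by blast

lemma \<Delta>_maximal:
  assumes "d \<in> segments (n + 3)" "d \<notin> \<Delta>" shows "\<exists>e \<in> \<Delta>. crossing d e"
proof -
  have "\<forall>d \<in> segments (n + 3) - \<Delta>. \<exists>e \<in> \<Delta>. crossing d e"
    using fan unfolding fan_triangulation_def triangulation_def by (elim conjE)
  then show ?thesis using assms by simp
qed

lemma noncrossing_\<Delta>: "noncrossing \<Delta>"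
  using fan by (auto simp: fan_triangulation_def triangulation_def noncrossing_def)

lemma sides_not_crossing:
  assumes "d \<in> sides (n + 3)" "e \<in> segments (n + 3)"
  shows "\<not> crossing d e"
proof
  assume "crossing d e"
  then obtain a b a' b' where c: "a < b" "b < a'" "a' < b'" "d = {a, a'} \<and> e = {b, b'} \<or> e = {a, a'} \<and> d = {b, b'}"
    unfolding crossing_def by blast
  obtain i where i: "d = {i, (i + 1) mod (n + 3)}" "i < n + 3"
    using assms(1) unfolding sides_def by blast
  have "b' < n + 3"
    using c(4) assms(2) i by (auto simp: segments_def doubleton_eq_iff)
  with c i show False
    by (auto simp: doubleton_eq_iff mod_if split: if_splits)
qed

lemma side_iff:
  assumes "p < q" "q < n + 3"
  shows "{w p, w q} \<in> sides (n + 3) \<longleftrightarrow> q = Suc p \<or> p = 0 \<and> q = n + 2"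
proof -
  have "{w p, w q} \<in> sides (n + 3) \<longleftrightarrow> w q = (w p + 1) mod (n + 3) \<or> w p = (w q + 1) mod (n + 3)"
    unfolding sides_def using w_less by (auto simp: doubleton_eq_iff)
  moreover have "(w i + 1) mod (n + 3) = w (Suc i)" for i
    by (simp add: w_def mod_Suc_eq)
  moreover have "w q = w (Suc p) \<longleftrightarrow> q = Suc p"
    using assms by (intro w_eq_iff) auto
  moreover have "w p = w (Suc q) \<longleftrightarrow> p = 0 \<and> q = n + 2"
  proof (cases "q = n + 2")
    case True
    then have "Suc q = n + 3" by simp
    then have "w (Suc q) = w 0"
      by (simp only: w_def mod_add_self2 add_0_right)
    then show ?thesis using w_eq_iff[of p 0] True assms by simp
  next
    case False
    then show ?thesis using w_eq_iff[of p "Suc q"] assms by auto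
  qed
  ultimately show ?thesis by simp
qed

text \<open>
  By maximality a missing segment at the apex is crossed by an element of \<open>\<Delta>\<close>; this is no side of
  the polygon, so it contains the apex itself and does not cross. Hence the fan consists of the
  sides and all segments at the apex.
\<close>

lemma \<Delta>_iff:
  assumes "p < q" "q < n + 3"
  shows "{w p, w q} \<in> \<Delta> \<longleftrightarrow> p = 0 \<or> q = Suc p"
proof
  assume \<Delta>: "{w p, w q} \<in> \<Delta>"
  show "p = 0 \<or> q = Suc p"
  proof (cases "{w p, w q} \<in> sides (n + 3)")
    case True
    then show ?thesis using side_iff[OF assms] by auto
  next
    case False
    with \<Delta> have "w 0 = w p \<or> w 0 = w q"
      using \<Delta>_diagonal unfolding w_0 by blast
    then show ?thesis
      using w_eq_iff[of 0 p] w_eq_iff[of 0 q] assms by simp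
  qed
next
  assume pq: "p = 0 \<or> q = Suc p"
  show "{w p, w q} \<in> \<Delta>"
  proof (rule ccontr)
    assume "{w p, w q} \<notin> \<Delta>"
    moreover have seg: "{w p, w q} \<in> segments (n + 3)"
      using assms w_less w_eq_iff[of p q] unfolding segments_def by fastforce
    ultimately obtain e where e: "e \<in> \<Delta>" "crossing {w p, w q} e"
      using \<Delta>_maximal by blast
    then have "{w p, w q} \<notin> sides (n + 3)" "e \<notin> sides (n + 3)"
      using sides_not_crossing \<Delta>_segments seg crossing_sym by blast+
    then have "p = 0" "k \<in> e"
      using pq side_iff[OF assms] e(1) \<Delta>_diagonal by blast+
    with e(2) show False
      by (auto simp: crossing_def w_0 doubleton_eq_iff)
  qed
qed

lemma \<Delta>_edge_cases:
  assumes "{a, b} \<in> \<Delta>" "a \<noteq> b"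
  obtains i j where "i < n + 3" "j < n + 3" "a = w i" "b = w j" "i \<noteq> j"
    "i = 0 \<or> j = 0 \<or> j = Suc i \<or> i = Suc j"
proof -
  have "a < n + 3" "b < n + 3"
    using \<Delta>_segments[OF assms(1)] by (auto simp: segments_def doubleton_eq_iff)
  then obtain i j where ij: "i < n + 3" "a = w i" "j < n + 3" "b = w j"
    using w_surj by metis
  with assms have "i \<noteq> j" by auto
  moreover have "i = 0 \<or> j = 0 \<or> j = Suc i \<or> i = Suc j"
    using \<Delta>_iff[of i j] \<Delta>_iff[of j i] ij assms(1) \<open>i \<noteq> j\<close> by (auto simp: insert_commute neq_iff)
  ultimately show ?thesis using that ij by blast
qed

lemma \<Delta>_triangles:
  "clockwise a b c \<and> is_triangle \<Delta> a b c \<longleftrightarrow> (\<exists>p. 1 \<le> p \<and> p \<le> n + 1 \<and>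
     (a, b, c) \<in> {(k, w p, w (Suc p)), (w p, w (Suc p), k), (w (Suc p), k, w p)})"
proof
  assume abc: "clockwise a b c \<and> is_triangle \<Delta> a b c"
  then have d: "{a, b} \<in> \<Delta>" "{b, c} \<in> \<Delta>" "{a, c} \<in> \<Delta>" "a \<noteq> b" "b \<noteq> c" "a \<noteq> c"
    by (auto simp: is_triangle_def)
  from \<Delta>_edge_cases[OF d(1,4)] obtain x y where xy: "x < n + 3" "y < n + 3" "a = w x" "b = w y"
    "x = 0 \<or> y = 0 \<or> y = Suc x \<or> x = Suc y" by metis
  from \<Delta>_edge_cases[OF d(2,5)] obtain z where z: "z < n + 3" "c = w z"
    "y = 0 \<or> z = 0 \<or> z = Suc y \<or> y = Suc z" using xy w_eq_iff by metis
  from \<Delta>_edge_cases[OF d(3,6)] have xz: "x = 0 \<or> z = 0 \<or> z = Suc x \<or> x = Suc z"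
    using xy z w_eq_iff by metis
  have c: "clockwise x y z"
    using abc xy z clockwise_w by simp
  have "x = 0 \<and> 1 \<le> y \<and> z = Suc y \<or> z = 0 \<and> 1 \<le> x \<and> y = Suc x \<or> y = 0 \<and> 1 \<le> z \<and> x = Suc z"
    using xy z xz c unfolding clockwise_def by linarith
  then show "\<exists>p. 1 \<le> p \<and> p \<le> n + 1 \<and>
     (a, b, c) \<in> {(k, w p, w (Suc p)), (w p, w (Suc p), k), (w (Suc p), k, w p)}"
    using xy z w_0 by auto
next
  assume "\<exists>p. 1 \<le> p \<and> p \<le> n + 1 \<and>
     (a, b, c) \<in> {(k, w p, w (Suc p)), (w p, w (Suc p), k), (w (Suc p), k, w p)}"
  then obtain p where p: "1 \<le> p" "p \<le> n + 1"
    "(a, b, c) \<in> {(k, w p, w (Suc p)), (w p, w (Suc p), k), (w (Suc p), k, w p)}" by blast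
  have "clockwise k (w p) (w (Suc p))"
    using p clockwise_w[of 0 p "Suc p"] by (simp add: w_0 clockwise_def)
  moreover have "is_triangle \<Delta> k (w p) (w (Suc p))"
    using p \<Delta>_iff[of 0 p] \<Delta>_iff[of 0 "Suc p"] \<Delta>_iff[of p "Suc p"] w_eq_iff[of 0 p] w_eq_iff[of 0 "Suc p"]
      w_eq_iff[of p "Suc p"] by (auto simp: w_0 is_triangle_def)
  ultimately show "clockwise a b c \<and> is_triangle \<Delta> a b c"
    using p(3) clockwise_rotate triangle_permute by blast
qed

definition spoke :: "nat \<Rightarrow> node" where "spoke p = Edge k (w p)"

definition fan_tri :: "nat \<Rightarrow> node" where "fan_tri p = Face {|k, w p, w (Suc p)|}"

lemma fan_face_eq: "fan_face (n + 3) k = {|k, w 1, w (n + 2)|}"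
  by (simp add: fan_face_def w_def)

text \<open>
  The diagonals at the apex are flipped one after the other, the diagonal to position \<open>m\<close> being
  replaced by the one from position \<open>1\<close> to \<open>m + 1\<close>. The flip creates the triangle at positions
  \<open>0, 1, m + 1\<close>, and the last of these triangles is the fan face.
\<close>

lemma fan_face_reachable:
  obtains T s where "flip_reachable \<Delta> T s" "is_triangle T k (w 1) (w (n + 2))"
proof -
  have "m \<le> n \<Longrightarrow> \<exists>T s. flip_reachable \<Delta> T s \<and> {w 1, w (m + 2)} \<in> T \<and> {k, w 1} \<in> T \<and>
      (\<forall>p. m + 2 \<le> p \<longrightarrow> p \<le> n + 2 \<longrightarrow> {k, w p} \<in> T) \<and>
      (\<forall>p. m + 2 \<le> p \<longrightarrow> p \<le> n + 1 \<longrightarrow> {w p, w (Suc p)} \<in> T)" for m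
  proof (induction m)
    case 0
    have "{w 1, w 2} \<in> \<Delta>" using \<Delta>_iff[of 1 2] by simp
    moreover have "{k, w p} \<in> \<Delta>" if "1 \<le> p" "p \<le> n + 2" for p
      using \<Delta>_iff[of 0 p] that by (simp add: w_0)
    moreover have "{w p, w (Suc p)} \<in> \<Delta>" if "p \<le> n + 1" for p
      using \<Delta>_iff[of p "Suc p"] that by simp
    ultimately show ?case
      by (intro exI[of _ \<Delta>] exI[of _ "initial_seed \<Delta>"]) (auto intro: flip_reachable.initial simp: numeral_2_eq_2)
  next
    case (Suc m)
    then obtain T s where T: "flip_reachable \<Delta> T s" "{w 1, w (m + 2)} \<in> T" "{k, w 1} \<in> T"
      "\<And>p. m + 2 \<le> p \<Longrightarrow> p \<le> n + 2 \<Longrightarrow> {k, w p} \<in> T"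
      "\<And>p. m + 2 \<le> p \<Longrightarrow> p \<le> n + 1 \<Longrightarrow> {w p, w (Suc p)} \<in> T"
      by auto
    have ne: "w p \<noteq> w q" if "p < q" "q \<le> n + 2" for p q
      using that by (simp add: w_eq_iff)
    have ne_k: "w p \<noteq> k" if "0 < p" "p \<le> n + 2" for p
      using ne[of 0 p] that by (simp add: w_0)
    have "is_triangle T (w 1) k (w (m + 2))"
      using T(2,3) T(4)[of "m + 2"] Suc.prems ne[of 1 "m + 2"] ne_k[of 1] ne_k[of "m + 2"]
      by (auto simp: is_triangle_def insert_commute)
    moreover have "is_triangle T (w (m + 3)) k (w (m + 2))"
      using T(4)[of "m + 2"] T(4)[of "m + 3"] T(5)[of "m + 2"] Suc.prems
        ne[of "m + 2" "m + 3"] ne_k[of "m + 2"] ne_k[of "m + 3"]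
      by (auto simp: is_triangle_def insert_commute numeral_eq_Suc)
    moreover have "w 1 \<noteq> w (m + 3)"
      using ne[of 1 "m + 3"] Suc.prems by simp
    ultimately have "flip_reachable \<Delta> (insert {w 1, w (m + 3)} (T - {{k, w (m + 2)}}))
        (flip_seed (w 1) (w (m + 3)) k (w (m + 2)) s)"
      using T(1) flip_reachable.flip by blast
    moreover have "{k, w 1} \<noteq> {k, w (m + 2)}"
      using ne[of 1 "m + 2"] Suc.prems by (auto simp: doubleton_eq_iff)
    moreover have "{k, w p} \<noteq> {k, w (m + 2)}" if "Suc m + 2 \<le> p" "p \<le> n + 2" for p
      using ne[of "m + 2" p] that by (auto simp: doubleton_eq_iff)
    moreover have "{w p, w (Suc p)} \<noteq> {k, w (m + 2)}" if "Suc m + 2 \<le> p" "p \<le> n + 1" for p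
      using ne_k[of p] ne_k[of "Suc p"] that by (auto simp: doubleton_eq_iff)
    ultimately show ?case
      using T by (intro exI[of _ "insert {w 1, w (m + 3)} (T - {{k, w (m + 2)}})"] exI) (auto simp: numeral_eq_Suc)
  qed
  from this[of n] obtain T s where T: "flip_reachable \<Delta> T s" "{w 1, w (n + 2)} \<in> T" "{k, w 1} \<in> T" "{k, w (n + 2)} \<in> T"
    by auto
  then have "is_triangle T k (w 1) (w (n + 2))"
    using w_eq_iff[of 1 "n + 2"] w_eq_iff[of 0 1] w_eq_iff[of 0 "n + 2"] by (auto simp: is_triangle_def w_0)
  with T that show ?thesis by blast
qed

section \<open>The cluster variable of the fan face\<close>

text \<open>
  The flags of \<open>fan_flags\<close> are chosen such that their coordinates on the fan are the initial cluster
  variables. The fan face is the triangle at positions \<open>0, 1, n + 2\<close>, so its variable is the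
  telescoping sum found there.
\<close>

lemma face_variable_fan_face:
  "face_variable \<Delta> (fan_face (n + 3) k) = indeterminate (spoke 1) * indeterminate (spoke (n + 2)) *
     (\<Sum>m = 1..n + 1. indeterminate (fan_tri m) / (indeterminate (spoke m) * indeterminate (spoke (Suc m))))"
proof -
  obtain X D where flags: "flag_coordinates X D"
    and XD: "\<forall>i>0. X 0 i = indeterminate (Edge (w 0) (w i)) \<and> X i 0 = indeterminate (Edge (w i) (w 0)) \<and>
      X i (Suc i) = indeterminate (Edge (w i) (w (Suc i))) \<and>
      X (Suc i) i = indeterminate (Edge (w (Suc i)) (w i)) \<and> D 0 i (Suc i) = indeterminate (fan_tri i) \<and>
      D 0 1 i = indeterminate (Edge (w 0) (w 1)) * indeterminate (Edge (w 0) (w i)) *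
        (\<Sum>m = 1..<i. indeterminate (fan_tri m) / (indeterminate (Edge (w 0) (w m)) * indeterminate (Edge (w 0) (w (Suc m)))))"
    using fan_flags[of "\<lambda>i j. indeterminate (Edge (w i) (w j))" "\<lambda>i. indeterminate (fan_tri i)",
        OF indeterminate_nonzero indeterminate_nonzero] by (elim exE conjE)
  have X: "X 0 i = indeterminate (Edge (w 0) (w i))" "X i 0 = indeterminate (Edge (w i) (w 0))"
    "X i (Suc i) = indeterminate (Edge (w i) (w (Suc i)))" "X (Suc i) i = indeterminate (Edge (w (Suc i)) (w i))"
    and D: "D 0 i (Suc i) = indeterminate (fan_tri i)" if "0 < i" for i
    using XD that by blast+
  define pos where "pos = inv_into {..<n + 3} w"
  have pos: "pos (w p) = p" if "p < n + 3" for p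
    unfolding pos_def using that w_eq_iff by (intro inv_into_f_f inj_onI) auto
  have pos_k: "pos k = 0" using pos[of 0] by (simp add: w_0)
  let ?X = "\<lambda>a b. X (pos a) (pos b)" and ?D = "\<lambda>a b c. D (pos a) (pos b) (pos c)"
  have flags': "flag_coordinates ?X ?D"
    using flags by (rule flag_coordinates_pullback)
  interpret flag_coordinates ?X ?D by (rule flags')
  have init: "matches \<Delta> (initial_seed \<Delta>)"
    unfolding matches_def
  proof (intro conjI allI impI)
    fix a b assume "a \<noteq> b" "{a, b} \<in> \<Delta>"
    then obtain i j where "i < n + 3" "j < n + 3" "a = w i" "b = w j" "i \<noteq> j"
      "i = 0 \<or> j = 0 \<or> j = Suc i \<or> i = Suc j"
      using \<Delta>_edge_cases by metis
    then show "var (initial_seed \<Delta>) (Edge a b) = ?X a b"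
      by (cases i; cases j) (auto simp: pos X initial_seed_def)
  next
    fix a b c assume abc: "clockwise a b c" "is_triangle \<Delta> a b c"
    obtain p where p: "1 \<le> p" "p \<le> n + 1"
      "(a, b, c) \<in> {(k, w p, w (Suc p)), (w p, w (Suc p), k), (w (Suc p), k, w p)}"
      using \<Delta>_triangles[THEN iffD1, OF conjI[OF abc]] by (elim exE conjE)
    have F: "{|w p, w (Suc p), k|} = {|k, w p, w (Suc p)|}" "{|w (Suc p), k, w p|} = {|k, w p, w (Suc p)|}"
      by auto
    have face: "Face {|a, b, c|} = fan_tri p"
      using p(3) by (auto simp: fan_tri_def F)
    have "?D a b c = ?D k (w p) (w (Suc p))"
      using p(3) cyclic[of k "w p" "w (Suc p)"] cyclic[of "w (Suc p)" k "w p"] by auto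
    also have "\<dots> = indeterminate (fan_tri p)"
      using p D by (simp add: pos pos_k)
    finally show "var (initial_seed \<Delta>) (Face {|a, b, c|}) = ?D a b c"
      by (simp add: face initial_seed_def)
  qed
  obtain T s where T: "flip_reachable \<Delta> T s" "is_triangle T k (w 1) (w (n + 2))"
    by (rule fan_face_reachable)
  have "clockwise k (w 1) (w (n + 2))"
    using clockwise_w[of 0 1 "n + 2"] by (simp add: w_0 clockwise_def)
  then have "face_variable \<Delta> (fan_face (n + 3) k) = ?D k (w 1) (w (n + 2))"
    unfolding fan_face_eq using face_variable_eq[OF flags' noncrossing_\<Delta> init T] by simp
  also have "\<dots> = D 0 1 (n + 2)"
    using pos[of 1] pos[of "n + 2"] pos_k by simp
  also have "\<dots> = indeterminate (Edge (w 0) (w 1)) * indeterminate (Edge (w 0) (w (n + 2))) *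
      (\<Sum>m = 1..<n + 2. indeterminate (fan_tri m) / (indeterminate (Edge (w 0) (w m)) * indeterminate (Edge (w 0) (w (Suc m)))))"
    using XD by simp
  also have "{1..<n + 2} = {1..n + 1}" by auto
  finally show ?thesis unfolding spoke_def w_0 .
qed

end

section \<open>The expansion poset\<close>

lemma indeterminate_mult_divide:
  "indeterminate a * indeterminate b * (indeterminate c / (indeterminate d * indeterminate e)) =
   to_fract (Poly_Mapping.single (Poly_Mapping.single a 1 + Poly_Mapping.single b 1 + Poly_Mapping.single c 1
     - Poly_Mapping.single d 1 - Poly_Mapping.single e 1) 1)" (is "_ = to_fract (Poly_Mapping.single ?m 1)")
proof -
  have "to_fract (Poly_Mapping.single ?m 1) * (indeterminate d * indeterminate e) =
      indeterminate a * indeterminate b * indeterminate c"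
    unfolding indeterminate_def to_fract_mult[symmetric] mult_single by (simp add: algebra_simps)
  moreover have "indeterminate d * indeterminate e \<noteq> 0"
    by (simp add: indeterminate_nonzero)
  ultimately show ?thesis
    unfolding times_divide_eq_right by (subst nonzero_divide_eq_eq) (auto simp only:)
qed

lemma keys_sum_single:
  assumes "finite A" "inj_on f A" "c \<noteq> 0"
  shows "Poly_Mapping.keys (\<Sum>a\<in>A. Poly_Mapping.single (f a) c) = f ` A"
proof (rule set_eqI)
  fix x
  have "Poly_Mapping.lookup (\<Sum>a\<in>A. Poly_Mapping.single (f a) c) x = (\<Sum>a\<in>A. if f a = x then c else 0)"
    by (simp add: lookup_sum lookup_single when_def)
  also have "\<dots> = (if x \<in> f ` A then c else 0)"
  proof (cases "x \<in> f ` A")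
    case True
    then obtain b where b: "b \<in> A" "x = f b" by blast
    then have "(\<Sum>a\<in>A. if f a = x then c else 0) = (\<Sum>a\<in>A. if a = b then c else 0)"
      using assms(2) by (intro sum.cong) (auto dest: inj_onD)
    then show ?thesis using True b assms(1) by simp
  qed (auto intro!: sum.neutral)
  finally show "x \<in> Poly_Mapping.keys (\<Sum>a\<in>A. Poly_Mapping.single (f a) c) \<longleftrightarrow> x \<in> f ` A"
    using assms(3) by (simp add: in_keys_iff)
qed

lemma lookup_unit: "Poly_Mapping.lookup (Poly_Mapping.single a 1) b = (of_bool (a = b) :: int)"
  by (simp add: lookup_single)

context fan
begin

definition term_monomial :: "nat \<Rightarrow> monomial" where
  "term_monomial m = Poly_Mapping.single (spoke 1) 1 + Poly_Mapping.single (spoke (n + 2)) 1 +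
     Poly_Mapping.single (fan_tri m) 1 - Poly_Mapping.single (spoke m) 1 - Poly_Mapping.single (spoke (Suc m)) 1"

lemma expansion_fan_face:
  "expansion \<Delta> (fan_face (n + 3) k) = (\<Sum>m = 1..n + 1. Poly_Mapping.single (term_monomial m) 1)"
  unfolding expansion_def
proof (rule the_equality)
  show eq: "to_fract (\<Sum>m = 1..n + 1. Poly_Mapping.single (term_monomial m) 1) = face_variable \<Delta> (fan_face (n + 3) k)"
    unfolding face_variable_fan_face to_fract_sum sum_distrib_left
    by (intro sum.cong refl) (simp only: indeterminate_mult_divide term_monomial_def)
  show "P = (\<Sum>m = 1..n + 1. Poly_Mapping.single (term_monomial m) 1)"
    if "to_fract P = face_variable \<Delta> (fan_face (n + 3) k)" for P
    using that eq by (metis to_fract_eq_iff)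
qed

lemma fan_tri_eq_iff:
  assumes "1 \<le> m" "m \<le> n + 1" "1 \<le> p" "p \<le> n + 1"
  shows "fan_tri m = fan_tri p \<longleftrightarrow> m = p"
proof
  assume "fan_tri m = fan_tri p"
  then have "{|k, w m, w (Suc m)|} = {|k, w p, w (Suc p)|}"
    by (simp add: fan_tri_def)
  then have "fset {|k, w m, w (Suc m)|} = fset {|k, w p, w (Suc p)|}" by simp
  then have "w ` {0, m, Suc m} = w ` {0, p, Suc p}"
    by (simp add: w_0)
  moreover have "inj_on w {..<n + 3}"
    using w_eq_iff by (auto intro!: inj_onI)
  ultimately have "{0, m, Suc m} = {0, p, Suc p}"
    using assms by (subst (asm) inj_on_image_eq_iff[of w "{..<n + 3}"]) auto
  then have "m \<in> {0, p, Suc p}" "Suc m \<in> {0, p, Suc p}" by blast+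
  then show "m = p"
    using assms by auto
qed simp

lemma lookup_term_fan_tri:
  assumes "1 \<le> m" "m \<le> n + 1" "1 \<le> p" "p \<le> n + 1"
  shows "Poly_Mapping.lookup (term_monomial m) (fan_tri p) = of_bool (m = p)"
proof -
  have "spoke i \<noteq> fan_tri p" for i
    by (simp add: spoke_def fan_tri_def)
  then show ?thesis
    unfolding term_monomial_def lookup_add lookup_minus lookup_unit fan_tri_eq_iff[OF assms] by simp
qed

text \<open>
  Variables of directed edges not starting at the apex occur in no term. This is what excludes all
  mutable nodes but the diagonals \<open>Edge k (w p)\<close> from the covering relations.
\<close>

lemma lookup_term_outer_edge:
  "a \<noteq> k \<Longrightarrow> Poly_Mapping.lookup (term_monomial m) (Edge a b) = 0"
  unfolding term_monomial_def lookup_add lookup_minus lookup_unit by (simp add: spoke_def fan_tri_def)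

lemma inj_on_term_monomial: "inj_on term_monomial {1..n + 1}"
proof (rule inj_onI)
  fix a b assume ab: "a \<in> {1..n + 1}" "b \<in> {1..n + 1}" and eq: "term_monomial a = term_monomial b"
  have "(of_bool (b = a) :: int) = Poly_Mapping.lookup (term_monomial b) (fan_tri a)"
    using ab lookup_term_fan_tri[of b a] by simp
  also have "\<dots> = Poly_Mapping.lookup (term_monomial a) (fan_tri a)"
    by (simp only: eq)
  also have "\<dots> = 1"
    using ab lookup_term_fan_tri[of a a] by simp
  finally show "a = b"
    by (simp split: if_splits)
qed

lemma expansion_monomials_fan_face:
  "expansion_monomials \<Delta> (fan_face (n + 3) k) = term_monomial ` {1..n + 1}"
  unfolding expansion_monomials_def expansion_fan_face
  by (rule keys_sum_single) (use inj_on_term_monomial in auto)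

definition fan_tri_arrows :: "nat \<Rightarrow> (node \<times> node) set" where
  "fan_tri_arrows p = {(spoke p, fan_tri p), (fan_tri p, spoke (Suc p)), (spoke (Suc p), spoke p),
     (Edge (w p) (w (Suc p)), fan_tri p), (fan_tri p, Edge (w p) k), (Edge (w p) k, Edge (w p) (w (Suc p))),
     (Edge (w (Suc p)) k, fan_tri p), (fan_tri p, Edge (w (Suc p)) (w p)), (Edge (w (Suc p)) (w p), Edge (w (Suc p)) k)}"

lemma arrow_\<Delta>_iff:
  "arrow \<Delta> u v \<longleftrightarrow> (\<exists>p. 1 \<le> p \<and> p \<le> n + 1 \<and> (u, v) \<in> fan_tri_arrows p)"
proof -
  have F: "{|w p, w (Suc p), k|} = {|k, w p, w (Suc p)|}" "{|w (Suc p), k, w p|} = {|k, w p, w (Suc p)|}" for p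
    by auto
  have corners: "fan_tri_arrows p = corner_arrows k (w p) (w (Suc p)) \<union> corner_arrows (w p) (w (Suc p)) k \<union>
      corner_arrows (w (Suc p)) k (w p)" for p
    unfolding fan_tri_arrows_def corner_arrows_def F fan_tri_def spoke_def by (simp only: Un_insert_left Un_empty_left)
  have "arrow \<Delta> u v \<longleftrightarrow> (\<exists>a b c. (clockwise a b c \<and> is_triangle \<Delta> a b c) \<and> (u, v) \<in> corner_arrows a b c)"
    by (simp add: arrow_iff_corner)
  also have "\<dots> \<longleftrightarrow> (\<exists>p. 1 \<le> p \<and> p \<le> n + 1 \<and> (u, v) \<in> fan_tri_arrows p)"
    unfolding \<Delta>_triangles corners by fastforce
  finally show ?thesis .
qed

lemma finite_arrows: "finite {(u, v). arrow \<Delta> u v}"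
proof (rule finite_subset)
  show "{(u, v). arrow \<Delta> u v} \<subseteq> (\<Union>p \<in> {1..n + 1}. fan_tri_arrows p)"
    using arrow_\<Delta>_iff by auto
  show "finite (\<Union>p \<in> {1..n + 1}. fan_tri_arrows p)"
    by (simp add: fan_tri_arrows_def)
qed

lemma w_neq_k: "1 \<le> p \<Longrightarrow> p \<le> n + 2 \<Longrightarrow> w p \<noteq> k"
  using w_eq_iff[of p 0] by (simp add: w_0)

text \<open>
  The two triangles at the diagonal from the apex to position \<open>p + 1\<close> contribute two arrows to and two
  arrows from its node, and their monomial is the quotient of consecutive terms.
\<close>

lemma y_hat_spoke:
  assumes "1 \<le> p" "p \<le> n"
  shows "y_hat \<Delta> (spoke (Suc p)) + term_monomial (Suc p) = term_monomial p"
proof -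
  have spoke: "spoke i = spoke j \<longleftrightarrow> i = j" if "i \<le> n + 2" "j \<le> n + 2" for i j
    using that by (simp add: spoke_def w_eq_iff)
  have ne: "spoke i \<noteq> fan_tri j" "fan_tri j \<noteq> spoke i" for i j
    by (simp_all add: spoke_def fan_tri_def)
  have ne': "spoke i \<noteq> Edge (w j) b" if "1 \<le> j" "j \<le> n + 2" for i j b
    using w_neq_k[OF that] by (auto simp: spoke_def)
  \<comment> \<open>Only three of the nine arrows of a triangle touch a directed edge that starts at the apex.\<close>
  have arr: "(u, v) \<in> fan_tri_arrows i \<longleftrightarrow> u = spoke i \<and> v = fan_tri i \<or> u = fan_tri i \<and> v = spoke (Suc i) \<or> u = spoke (Suc i) \<and> v = spoke i"
    if "1 \<le> i" "i \<le> n + 1" "u = spoke (Suc p) \<or> v = spoke (Suc p)" for u v i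
    using that ne ne' unfolding fan_tri_arrows_def by auto
  have "{u. arrow \<Delta> u (spoke (Suc p))} = {fan_tri p, spoke (Suc (Suc p))}"
  proof (rule set_eqI)
    fix u
    have "arrow \<Delta> u (spoke (Suc p)) \<longleftrightarrow> (\<exists>i. 1 \<le> i \<and> i \<le> n + 1 \<and> (u = fan_tri i \<and> i = p \<or> u = spoke (Suc i) \<and> i = Suc p))"
      unfolding arrow_\<Delta>_iff using arr[of _ u "spoke (Suc p)"] ne spoke assms by auto
    then show "u \<in> {u. arrow \<Delta> u (spoke (Suc p))} \<longleftrightarrow> u \<in> {fan_tri p, spoke (Suc (Suc p))}"
      using assms by auto
  qed
  moreover have "{u. arrow \<Delta> (spoke (Suc p)) u} = {spoke p, fan_tri (Suc p)}"
  proof (rule set_eqI)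
    fix u
    have "arrow \<Delta> (spoke (Suc p)) u \<longleftrightarrow> (\<exists>i. 1 \<le> i \<and> i \<le> n + 1 \<and> (u = fan_tri i \<and> i = Suc p \<or> u = spoke i \<and> i = p))"
      unfolding arrow_\<Delta>_iff using arr[of _ "spoke (Suc p)" u] ne spoke assms by auto
    then show "u \<in> {u. arrow \<Delta> (spoke (Suc p)) u} \<longleftrightarrow> u \<in> {spoke p, fan_tri (Suc p)}"
      using assms by auto
  qed
  ultimately show ?thesis
    using ne by (simp add: y_hat_def term_monomial_def)
qed

text \<open>
  For a diagonal directed towards the apex the witness \<open>u\<close> is the side of the polygon from the other
  end of the diagonal to the preceding vertex; for a triangle it is the side opposite to the apex.
\<close>

lemma mutable_cases:
  assumes "v \<in> mutable_nodes (n + 3) \<Delta>"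
  obtains p where "1 \<le> p" "p \<le> n" "v = spoke (Suc p)"
  | u where "arrow \<Delta> u v" "\<exists>a b. u = Edge a b \<and> a \<noteq> k"
proof -
  consider a b where "v = Edge a b" "{a, b} \<in> \<Delta>" "{a, b} \<notin> sides (n + 3)"
    | a b c where "v = Face {|a, b, c|}" "is_triangle \<Delta> a b c"
    using assms unfolding mutable_nodes_def by blast
  then show ?thesis
  proof cases
    case 1
    have "a \<noteq> b"
      using \<Delta>_segments[OF 1(2)] by (auto simp: segments_def doubleton_eq_iff)
    with 1 obtain i j where ij: "i < n + 3" "j < n + 3" "a = w i" "b = w j" "i \<noteq> j"
      "i = 0 \<or> j = 0 \<or> j = Suc i \<or> i = Suc j"
      using \<Delta>_edge_cases by metis
    have "i = 0 \<and> 2 \<le> j \<and> j \<le> n + 1 \<or> j = 0 \<and> 2 \<le> i \<and> i \<le> n + 1"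
      using ij 1(3) side_iff[of i j] side_iff[of j i] by (auto simp: insert_commute)
    then show ?thesis
    proof
      assume j: "i = 0 \<and> 2 \<le> j \<and> j \<le> n + 1"
      then show ?thesis
        using ij 1 by (intro that(1)[of "j - 1"]) (auto simp: spoke_def w_0)
    next
      assume i: "j = 0 \<and> 2 \<le> i \<and> i \<le> n + 1"
      then obtain p where p: "i = Suc p" "1 \<le> p" "p \<le> n" by (cases i) auto
      have "(Edge (w (Suc p)) (w p), v) \<in> fan_tri_arrows p"
        using 1(1) ij i p by (simp add: fan_tri_arrows_def w_0)
      then have "arrow \<Delta> (Edge (w (Suc p)) (w p)) v"
        unfolding arrow_\<Delta>_iff using p by (intro exI[of _ p]) simp
      moreover have "w (Suc p) \<noteq> k"
        using p by (intro w_neq_k) auto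
      ultimately show ?thesis using that(2) by blast
    qed
  next
    case 2
    then have "a \<noteq> b" "b \<noteq> c" "a \<noteq> c" by (auto simp: is_triangle_def)
    then have "clockwise a b c \<or> clockwise a c b" by (intro clockwise_total)
    moreover have "is_triangle \<Delta> a c b" using 2(2) by (rule triangle_permute)
    moreover have "v = Face {|a, c, b|}" using 2(1) by (simp add: finsert_commute)
    ultimately obtain b' c' where v: "v = Face {|a, b', c'|}" and t: "clockwise a b' c' \<and> is_triangle \<Delta> a b' c'"
      using 2 by blast
    obtain p where p: "1 \<le> p" "p \<le> n + 1"
      "(a, b', c') \<in> {(k, w p, w (Suc p)), (w p, w (Suc p), k), (w (Suc p), k, w p)}"
      using \<Delta>_triangles[THEN iffD1, OF t] by (elim exE conjE)
    have F: "{|w p, w (Suc p), k|} = {|k, w p, w (Suc p)|}" "{|w (Suc p), k, w p|} = {|k, w p, w (Suc p)|}"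
      by auto
    have "v = fan_tri p"
      using p(3) v by (auto simp: fan_tri_def F)
    then have "(Edge (w p) (w (Suc p)), v) \<in> fan_tri_arrows p"
      by (simp add: fan_tri_arrows_def)
    then have "arrow \<Delta> (Edge (w p) (w (Suc p))) v"
      unfolding arrow_\<Delta>_iff using p(1,2) by (intro exI[of _ p]) simp
    moreover have "w p \<noteq> k"
      using p(1,2) by (intro w_neq_k) auto
    ultimately show ?thesis using that(2) by blast
  qed
qed

text \<open>
  If term \<open>b\<close> covers term \<open>a\<close> by means of the diagonal at position \<open>p + 1\<close>, then the exponents of the
  variables of the two triangles at this diagonal show that \<open>b = p\<close> and \<open>a = p + 1\<close>.
\<close>

lemma expansion_covers_iff:
  assumes a: "1 \<le> a" "a \<le> n + 1" and b: "1 \<le> b" "b \<le> n + 1"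
  shows "expansion_covers (n + 3) \<Delta> (fan_face (n + 3) k) (term_monomial a) (term_monomial b) \<longleftrightarrow> a = Suc b"
proof
  assume "expansion_covers (n + 3) \<Delta> (fan_face (n + 3) k) (term_monomial a) (term_monomial b)"
  then obtain v where v: "v \<in> mutable_nodes (n + 3) \<Delta>" "term_monomial b = y_hat \<Delta> v + term_monomial a"
    unfolding expansion_covers_def by blast
  from v(1) show "a = Suc b"
  proof (cases rule: mutable_cases)
    case (1 p)
    have "term_monomial b + term_monomial (Suc p) = term_monomial p + term_monomial a"
      using y_hat_spoke[OF 1(1,2)] v(2) 1(3) by (metis add.commute add.left_commute)
    then have eq: "Poly_Mapping.lookup (term_monomial b) x + Poly_Mapping.lookup (term_monomial (Suc p)) x =
        Poly_Mapping.lookup (term_monomial p) x + Poly_Mapping.lookup (term_monomial a) x" for x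
      by (metis lookup_add)
    have "of_bool (b = p) = (1 :: int) + of_bool (a = p)"
      using eq[of "fan_tri p"] a b 1(1,2) by (simp add: lookup_term_fan_tri)
    moreover have "of_bool (b = Suc p) + (1 :: int) = of_bool (a = Suc p)"
      using eq[of "fan_tri (Suc p)"] a b 1(1,2) by (simp add: lookup_term_fan_tri)
    ultimately show ?thesis by (auto split: if_splits simp: of_bool_def)
  next
    case (2 u)
    then have "Poly_Mapping.lookup (y_hat \<Delta> v) u = 1"
      using arrow_asym[OF 2(1)] by (simp add: lookup_y_hat[OF finite_arrows])
    moreover have "Poly_Mapping.lookup (term_monomial m) u = 0" for m
      using 2(2) lookup_term_outer_edge by blast
    ultimately show ?thesis
      using arg_cong[OF v(2), of "\<lambda>m. Poly_Mapping.lookup m u"] by (simp add: lookup_add)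
  qed
next
  assume ab: "a = Suc b"
  then have "b \<le> n" using a by simp
  have "{k, w a} \<in> \<Delta>"
    using \<Delta>_iff[of 0 a] a by (simp add: w_0)
  moreover have "{k, w a} \<notin> sides (n + 3)"
    using side_iff[of 0 a] ab a b by (simp add: w_0)
  ultimately have "spoke a \<in> mutable_nodes (n + 3) \<Delta>"
    unfolding mutable_nodes_def spoke_def by blast
  moreover have "term_monomial b = y_hat \<Delta> (spoke a) + term_monomial a"
    using y_hat_spoke[OF b(1) \<open>b \<le> n\<close>] ab by simp
  ultimately show "expansion_covers (n + 3) \<Delta> (fan_face (n + 3) k) (term_monomial a) (term_monomial b)"
    using a b unfolding expansion_covers_def expansion_monomials_fan_face
    by (intro conjI bexI imageI) simp_all
qed

lemma expansion_le_iff: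
  assumes "a \<in> {1..n + 1}" "b \<in> {1..n + 1}"
  shows "expansion_le (n + 3) \<Delta> (fan_face (n + 3) k) (term_monomial a) (term_monomial b) \<longleftrightarrow> b \<le> a"
proof
  assume "expansion_le (n + 3) \<Delta> (fan_face (n + 3) k) (term_monomial a) (term_monomial b)"
  then have "\<exists>c \<in> {1..n + 1}. term_monomial b = term_monomial c \<and> c \<le> a"
    unfolding expansion_le_def
  proof (induction rule: rtranclp_induct)
    case base
    show ?case using assms(1) by blast
  next
    case (step y z)
    then obtain c where c: "c \<in> {1..n + 1}" "y = term_monomial c" "c \<le> a" by blast
    from step.hyps(2) obtain d where d: "d \<in> {1..n + 1}" "z = term_monomial d"
      unfolding expansion_covers_def expansion_monomials_fan_face by blast
    have "c = Suc d"
      using step.hyps(2) c d expansion_covers_iff by simp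
    with c d show ?case by auto
  qed
  then show "b \<le> a"
    using inj_onD[OF inj_on_term_monomial] assms(2) by blast
next
  assume "b \<le> a"
  then show "expansion_le (n + 3) \<Delta> (fan_face (n + 3) k) (term_monomial a) (term_monomial b)"
    unfolding expansion_le_def using assms(1)
  proof (induction a rule: dec_induct)
    case (step m)
    have "expansion_covers (n + 3) \<Delta> (fan_face (n + 3) k) (term_monomial (Suc m)) (term_monomial m)"
      using step.hyps step.prems assms(2) by (subst expansion_covers_iff) auto
    moreover have "m \<in> {1..n + 1}"
      using step.hyps step.prems assms(2) by auto
    ultimately show ?case
      using step.IH by (meson converse_rtranclp_into_rtranclp)
  qed simp
qed

end

theorem proposition11p22:
  fixes n k :: nat and \<Delta> :: "nat set set"
  assumes "fan_triangulation (n + 3) \<Delta> k"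
  shows "\<exists>f. bij_betw f {..<n + 1} (expansion_monomials \<Delta> (fan_face (n + 3) k)) \<and>
    (\<forall>i \<in> {..<n + 1}. \<forall>j \<in> {..<n + 1}.
       i \<le> j \<longleftrightarrow> expansion_le (n + 3) \<Delta> (fan_face (n + 3) k) (f i) (f j))"
proof -
  interpret fan n k \<Delta> by unfold_locales (rule assms)
  \<comment> \<open>A covering step lowers the index of a term, so the minimum of the chain is term \<open>n + 1\<close>.\<close>
  let ?f = "\<lambda>i. term_monomial (n + 1 - i)"
  have "bij_betw (\<lambda>i. n + 1 - i) {..<n + 1} {1..n + 1}"
    by (rule bij_betw_byWitness[where f' = "\<lambda>i. n + 1 - i"]) auto
  moreover have "bij_betw term_monomial {1..n + 1} (expansion_monomials \<Delta> (fan_face (n + 3) k))"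
    unfolding expansion_monomials_fan_face using inj_on_term_monomial by (rule inj_on_imp_bij_betw)
  ultimately have "bij_betw ?f {..<n + 1} (expansion_monomials \<Delta> (fan_face (n + 3) k))"
    using bij_betw_trans by (fastforce simp: comp_def)
  moreover have "i \<le> j \<longleftrightarrow> expansion_le (n + 3) \<Delta> (fan_face (n + 3) k) (?f i) (?f j)"
    if "i \<in> {..<n + 1}" "j \<in> {..<n + 1}" for i j
    using that by (subst expansion_le_iff) auto
  ultimately show ?thesis by blast
qed

end
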